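(* Let $p\in(0,1)$ be a constant and let $G=G_p\in\mathcal{G}_{n,p}$ be a random graph. Let $RCW(G)$ be the reciprocal complementary Wiener matrix of $G$, with $(i,j)$-entry $\frac{1}{D(G)+1-D(i,j)}$ if $i\neq j$ and $0$ if $i=j$, where $D(G)$ is the diameter of $G$. Then $$\mathscr{E}(RCW(G))=\Big(\frac{4}{3\pi}\sqrt{p(1-p)}+o(1)\Big)n^{3/2}\quad\text{a.s.}$$
   Context: $D(i,j)$ is the distance between vertices $i$ and $j$ in $G$. The energy of a real symmetric matrix $M$ with eigenvalues $\lambda_1,\dots,\lambda_n$ is $\mathscr{E}(M)=\sum_{i=1}^n|\lambda_i|$. $\mathcal{G}_{n,p}$ is the Erdős–Rényi random graph model on $n$ vertices, each edge chosen independently with probability $p$. "a.s." means with probability tending to $1$ as $n\to\infty$; the $o(1)$ term is bounded in absolute value by a deterministic sequence tending to $0$ with probability tending to $1$. (With probability tending to $1$ the graph is connected with diameter $2$, so the convention for distances and diameter in disconnected graphs is irrelevant.) *)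

theory Defs
  imports
    "HOL-Probability.Product_PMF"
    "Graph_Theory.Graph_Theory"
    "Jordan_Normal_Form.Char_Poly"
begin

text \<open>
  A simple graph is represented by the symmetric loop-free digraph which has both arcs
  \<open>(u, v)\<close> and \<open>(v, u)\<close> for every edge \<open>{u, v}\<close>.
\<close>

definition vertex_pairs :: "nat \<Rightarrow> nat set set" where
  "vertex_pairs n = {e. e \<subseteq> {0..<n} \<and> card e = 2}"

definition graph_of :: "nat \<Rightarrow> (nat set \<Rightarrow> bool) \<Rightarrow> nat pair_pre_digraph" where
  "graph_of n X = \<lparr>pverts = {0..<n}, parcs = {(u, v). {u, v} \<in> vertex_pairs n \<and> X {u, v}}\<rparr>"

definition random_graph :: "nat \<Rightarrow> real \<Rightarrow> nat pair_pre_digraph pmf" where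
  "random_graph n p =
     map_pmf (graph_of n) (Pi_pmf (vertex_pairs n) False (\<lambda>_. bernoulli_pmf p))"

text \<open>
  The number of arcs of a shortest walk; it is \<open>\<infinity>\<close> if there is none.
\<close>
definition graph_dist :: "'a pair_pre_digraph \<Rightarrow> 'a \<Rightarrow> 'a \<Rightarrow> ereal" where
  "graph_dist G u v = wf_digraph.\<mu> (with_proj G) (\<lambda>_. 1) u v"

definition graph_diameter :: "'a pair_pre_digraph \<Rightarrow> ereal" where
  "graph_diameter G = (SUP u\<in>pverts G. SUP v\<in>pverts G. graph_dist G u v)"

text \<open>
  The vertex set is assumed to be an initial segment of the natural numbers. For a connected
  graph all the quantities in the denominator are finite and the denominator is at least \<open>1\<close>.
  For a disconnected graph the denominator is \<open>\<infinity>\<close> (as \<open>\<infinity> - \<infinity> = \<infinity>\<close> in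
  \<^typ>\<open>ereal\<close>) and the entry is \<open>0\<close>.
\<close>
definition rcw_matrix :: "nat pair_pre_digraph \<Rightarrow> real mat" where
  "rcw_matrix G = mat (card (pverts G)) (card (pverts G))
     (\<lambda>(i, j). if i = j then 0
               else real_of_ereal (1 / (graph_diameter G + 1 - graph_dist G i j)))"

text \<open>
  All roots of the characteristic polynomial of a real symmetric matrix are real, so that
  \<open>proots (char_poly M)\<close> is the multiset of all its eigenvalues, with multiplicities.
\<close>
definition mat_energy :: "real mat \<Rightarrow> real" where
  "mat_energy M = (\<Sum>x\<in>#proots (char_poly M). \<bar>x\<bar>)"

end

theory Submission
  imports Defs "HOL-Real_Asymp.Real_Asymp"
begin

text \<open>
  With probability tending to 1 the graph is not complete and any two of its vertices have a
  common neighbour. All distances between distinct vertices are then 1 or 2, the diameter is 2,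
  and the matrix has the entry 1/2 at every edge and 1 at every other off-diagonal place. So it is
  a symmetric matrix with independent entries, of variance \<open>\<sigma>\<^sup>2 = p (1 - p) / 4\<close> and equal means
  (\<open>rcw_matrix_diameter_two\<close>, \<open>prob_not_diameter_two_tendsto_0\<close>), and the claim is a semicircle law for
  the test function \<open>\<bar>\<lambda>\<bar>\<close>.

  Let \<open>H\<close> be the matrix divided by \<open>sqrt n\<close>, \<open>G = (H - z)\<^sup>-\<^sup>1\<close> and \<open>s(z) = tr G / n\<close>. Coulson's formula
  \<open>\<bar>\<lambda>\<bar> = 2/\<pi> \<integral>\<^sub>0\<^sup>\<infinity> \<lambda>\<^sup>2 / (\<lambda>\<^sup>2 + x\<^sup>2) dx\<close> expresses the energy of \<open>H\<close> divided by \<open>n\<close> as \<open>2/\<pi>\<close> times the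
  integral of \<open>Re (1 + z s(z))\<close> over \<open>z = i x\<close>, \<open>x > 0\<close> (\<open>Coulson_integral_energy\<close>). Hence \<open>s\<close> is needed
  on the imaginary axis only, where every resolvent bound is a power of \<open>1/x\<close>.

  For fixed \<open>x\<close> start from \<open>1 + z s = 1/n \<Sum> h\<^sub>i\<^sub>k G\<^sub>k\<^sub>i\<close>. An entry takes two values, so the expectation of
  \<open>h\<^sub>i\<^sub>k G\<^sub>k\<^sub>i\<close> is, exactly, the mean of \<open>h\<^sub>i\<^sub>k\<close> times that of \<open>G\<^sub>k\<^sub>i\<close> plus a multiple of the expected change of
  \<open>G\<^sub>k\<^sub>i\<close> when the edge \<open>{i, k}\<close> is flipped (\<open>coin_integration_by_parts\<close>). By the resolvent identity that
  change is quadratic in \<open>G\<close> with the main term \<open>G\<^sub>k\<^sub>k G\<^sub>i\<^sub>i\<close>. Summation gives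
  \<open>1 + z m + \<sigma>\<^sup>2 E s\<^sup>2 = O(1 / sqrt n)\<close> for the mean \<open>m\<close> of \<open>s\<close> (\<open>loop_equation\<close>). The common mean of the
  entries may stay: it contributes a multiple of the sum of all entries of \<open>G\<close>, which is at most
  \<open>n/x\<close> because \<open>G\<close> has norm at most \<open>1/x\<close>.

  One flip moves \<open>s\<close> by \<open>O(n\<^sup>-\<^sup>3\<^sup>/\<^sup>2)\<close> and there are at most \<open>n\<^sup>2\<close> coins, so the Efron-Stein inequality
  bounds the variance of \<open>s\<close> by \<open>O(1/n)\<close> (\<open>s_variance\<close>) and \<open>E s\<^sup>2\<close> may be replaced by \<open>m\<^sup>2\<close>. The Stieltjes
  transform \<open>m\<^sub>0\<close> of the semicircle law solves the limiting equation \<open>1 + z m\<^sub>0 + \<sigma>\<^sup>2 m\<^sub>0\<^sup>2 = 0\<close>, and the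
  difference of the two equations factors as \<open>(m - m\<^sub>0) (\<sigma>\<^sup>2 (m + m\<^sub>0) + i x)\<close>. Both \<open>m\<close> and \<open>m\<^sub>0\<close> have
  nonnegative imaginary part, so the second factor is at least \<open>x\<close> in modulus and \<open>m\<close> tends to \<open>m\<^sub>0\<close>.

  Finally the integrands \<open>Re (1 + z s)\<close> all lie below \<open>2 / (1 + x\<^sup>2)\<close>. Dominated convergence shows that
  the energy divided by \<open>n\<^sup>3\<^sup>/\<^sup>2\<close> converges in mean to \<open>2/\<pi>\<close> times the semicircle integral \<open>4\<sigma>/3\<close>, which
  is the constant claimed (\<open>expected_energy_error_tendsto_0\<close>), and Markov's inequality turns
  convergence in mean into an error bound that holds with probability tending to 1.
\<close>
section \<open>Resolvents of real symmetric matrices\<close>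

text \<open>
  Matrices are functions on \<open>nat \<times> nat\<close> restricted to indices below \<open>n\<close>: the dimension tends to
  infinity and the arguments below are manipulations of sums. The determinants of library matrices
  enter only through the existence of the resolvent and the eigenvalue formula for its trace.
\<close>

definition shift :: "(nat \<Rightarrow> nat \<Rightarrow> real) \<Rightarrow> complex \<Rightarrow> nat \<Rightarrow> nat \<Rightarrow> complex" where
  "shift h z i j = complex_of_real (h i j) - (if i = j then z else 0)"

definition symmetric_upto :: "nat \<Rightarrow> (nat \<Rightarrow> nat \<Rightarrow> real) \<Rightarrow> bool" where
  "symmetric_upto n h \<longleftrightarrow> (\<forall>i<n. \<forall>j<n. h i j = h j i)"

definition is_resolvent ::
  "nat \<Rightarrow> (nat \<Rightarrow> nat \<Rightarrow> real) \<Rightarrow> complex \<Rightarrow> (nat \<Rightarrow> nat \<Rightarrow> complex) \<Rightarrow> bool" where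
  "is_resolvent n h z G \<longleftrightarrow>
     (\<forall>i<n. \<forall>j<n. (\<Sum>k<n. shift h z i k * G k j) = (if i = j then 1 else 0) \<and>
                  (\<Sum>k<n. G i k * shift h z k j) = (if i = j then 1 else 0))"

lemma quadratic_form_real:
  assumes "symmetric_upto n h"
  shows "(\<Sum>i<n. \<Sum>k<n. cnj (y i) * complex_of_real (h i k) * y k) \<in> \<real>"
proof -
  let ?S = "(\<Sum>i<n. \<Sum>k<n. cnj (y i) * complex_of_real (h i k) * y k)"
  have "cnj ?S = (\<Sum>i<n. \<Sum>k<n. y i * complex_of_real (h i k) * cnj (y k))"
    by simp
  also have "\<dots> = (\<Sum>k<n. \<Sum>i<n. y i * complex_of_real (h i k) * cnj (y k))"
    by (rule sum.swap)
  also have "\<dots> = ?S"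
    using assms by (intro sum.cong refl) (auto simp: symmetric_upto_def mult_ac)
  finally show ?thesis by (simp add: Reals_cnj_iff)
qed

lemma sum_shift:
  assumes "i < n"
  shows "(\<Sum>k<n. shift h z i k * y k) = (\<Sum>k<n. complex_of_real (h i k) * y k) - z * y i"
    and "(\<Sum>k<n. y k * shift h z k i) = (\<Sum>k<n. y k * complex_of_real (h k i)) - y i * z"
proof -
  have "(\<Sum>k<n. shift h z i k * y k) =
      (\<Sum>k<n. complex_of_real (h i k) * y k - (if k = i then z * y i else 0))"
    by (intro sum.cong refl) (auto simp: shift_def algebra_simps)
  then show "(\<Sum>k<n. shift h z i k * y k) = (\<Sum>k<n. complex_of_real (h i k) * y k) - z * y i"
    using assms by (simp add: sum_subtractf)
  have "(\<Sum>k<n. y k * shift h z k i) =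
      (\<Sum>k<n. y k * complex_of_real (h k i) - (if k = i then y i * z else 0))"
    by (intro sum.cong refl) (auto simp: shift_def algebra_simps)
  then show "(\<Sum>k<n. y k * shift h z k i) = (\<Sum>k<n. y k * complex_of_real (h k i)) - y i * z"
    using assms by (simp add: sum_subtractf)
qed

lemma norm_sum_mult_le_L2_set:
  fixes f g :: "'a \<Rightarrow> complex"
  shows "cmod (\<Sum>i\<in>A. f i * g i) \<le> L2_set (\<lambda>i. cmod (f i)) A * L2_set (\<lambda>i. cmod (g i)) A"
proof -
  have "cmod (\<Sum>i\<in>A. f i * g i) \<le> (\<Sum>i\<in>A. cmod (f i * g i))" by (rule norm_sum)
  also have "\<dots> = (\<Sum>i\<in>A. \<bar>cmod (f i)\<bar> * \<bar>cmod (g i)\<bar>)" by (simp add: norm_mult)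
  also have "\<dots> \<le> L2_set (\<lambda>i. cmod (f i)) A * L2_set (\<lambda>i. cmod (g i)) A"
    by (rule L2_set_mult_ineq)
  finally show ?thesis .
qed

text \<open>
  In \<open>\<langle>y, (H - z) y\<rangle> = \<langle>y, H y\<rangle> - z \<parallel>y\<parallel>\<^sup>2\<close> the first term is real, so the imaginary part
  \<open>- Im z \<parallel>y\<parallel>\<^sup>2\<close> is at most \<open>\<parallel>y\<parallel> \<parallel>(H - z) y\<parallel>\<close> in modulus. This is the bound \<open>1 / \<bar>Im z\<bar>\<close> on the norm of
  the resolvent; it also shows that eigenvalues are real.
\<close>

lemma shift_bounded_below:
  assumes h: "symmetric_upto n h" and v: "\<And>i. i < n \<Longrightarrow> v i = (\<Sum>k<n. shift h z i k * y k)"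
  shows "\<bar>Im z\<bar> * L2_set (\<lambda>i. cmod (y i)) {..<n} \<le> L2_set (\<lambda>i. cmod (v i)) {..<n}"
proof -
  let ?N = "L2_set (\<lambda>i. cmod (y i)) {..<n}"
  let ?V = "L2_set (\<lambda>i. cmod (v i)) {..<n}"
  let ?Q = "(\<Sum>i<n. \<Sum>k<n. cnj (y i) * complex_of_real (h i k) * y k)"
  have N2: "?N\<^sup>2 = (\<Sum>i<n. (cmod (y i))\<^sup>2)"
    by (simp add: L2_set_def sum_nonneg)
  have "(\<Sum>i<n. cnj (y i) * v i) = (\<Sum>i<n. cnj (y i) * ((\<Sum>k<n. complex_of_real (h i k) * y k) - z * y i))"
    by (intro sum.cong refl) (simp add: v sum_shift)
  also have "\<dots> = ?Q - z * (\<Sum>i<n. complex_of_real ((cmod (y i))\<^sup>2))"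
    unfolding complex_norm_square
    by (simp add: right_diff_distrib sum_subtractf sum_distrib_left mult_ac)
  finally have "Im (\<Sum>i<n. cnj (y i) * v i) = - Im z * ?N\<^sup>2"
    using quadratic_form_real[OF h, of y] by (simp add: N2 complex_is_Real_iff)
  then have "\<bar>Im z\<bar> * ?N\<^sup>2 \<le> cmod (\<Sum>i<n. cnj (y i) * v i)"
    using abs_Im_le_cmod[of "\<Sum>i<n. cnj (y i) * v i"] by (simp add: abs_mult)
  also have "\<dots> \<le> ?N * ?V"
    using norm_sum_mult_le_L2_set[of "\<lambda>i. cnj (y i)" v "{..<n}"] by simp
  finally have *: "?N * (\<bar>Im z\<bar> * ?N) \<le> ?N * ?V" by (simp add: power2_eq_square mult_ac)
  show ?thesis
  proof (cases "?N = 0")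
    case False
    then have "?N > 0" using L2_set_nonneg[of "\<lambda>i. cmod (y i)" "{..<n}"] by linarith
    with * show ?thesis by simp
  qed (simp add: L2_set_nonneg)
qed

lemma resolvent_column:
  assumes h: "symmetric_upto n h" and G: "is_resolvent n h z G" and z: "Im z > 0" and j: "j < n"
  shows "(\<Sum>i<n. (cmod (G i j))\<^sup>2) \<le> 1 / (Im z)\<^sup>2"
proof -
  have "\<bar>Im z\<bar> * L2_set (\<lambda>i. cmod (G i j)) {..<n} \<le> L2_set (\<lambda>i. cmod (if i = j then 1 else 0)) {..<n}"
    by (rule shift_bounded_below[OF h]) (use G j in \<open>auto simp: is_resolvent_def\<close>)
  also have "L2_set (\<lambda>i. cmod (if i = j then 1 else 0)) {..<n} = 1"
    using j by (simp add: L2_set_def if_distrib[where f = cmod] if_distrib[where f = "\<lambda>x. x\<^sup>2"] cong: if_cong)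
  finally have "L2_set (\<lambda>i. cmod (G i j)) {..<n} \<le> 1 / Im z"
    using z by (simp add: field_simps)
  then have "(L2_set (\<lambda>i. cmod (G i j)) {..<n})\<^sup>2 \<le> (1 / Im z)\<^sup>2"
    by (rule power_mono) (rule L2_set_nonneg)
  then show ?thesis by (simp add: L2_set_def sum_nonneg power_divide)
qed

lemma resolvent_entry:
  assumes "symmetric_upto n h" "is_resolvent n h z G" "Im z > 0" "i < n" "j < n"
  shows "cmod (G i j) \<le> 1 / Im z"
proof -
  have "(cmod (G i j))\<^sup>2 \<le> (\<Sum>i<n. (cmod (G i j))\<^sup>2)"
    using assms by (intro member_le_sum) auto
  also have "\<dots> \<le> (1 / Im z)\<^sup>2" using resolvent_column[OF assms(1-3,5)] by (simp add: power_divide)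
  finally show ?thesis by (rule power2_le_imp_le) (use assms(3) in simp)
qed

lemma resolvent_quadratic_form:
  assumes h: "symmetric_upto n h" and G: "is_resolvent n h z G" and z: "Im z > 0"
  shows "cmod (\<Sum>i<n. \<Sum>j<n. complex_of_real (v i) * G i j * complex_of_real (v j)) \<le> (\<Sum>i<n. (v i)\<^sup>2) / Im z"
proof -
  define y where "y i = (\<Sum>j<n. G i j * complex_of_real (v j))" for i
  let ?V = "L2_set (\<lambda>i. cmod (complex_of_real (v i))) {..<n}"
  let ?Y = "L2_set (\<lambda>i. cmod (y i)) {..<n}"
  have "complex_of_real (v i) = (\<Sum>k<n. shift h z i k * y k)" if i: "i < n" for i
  proof -
    have "(\<Sum>k<n. shift h z i k * y k) = (\<Sum>k<n. \<Sum>j<n. shift h z i k * G k j * complex_of_real (v j))"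
      by (simp add: y_def sum_distrib_left mult.assoc)
    also have "\<dots> = (\<Sum>j<n. \<Sum>k<n. shift h z i k * G k j * complex_of_real (v j))"
      by (rule sum.swap)
    also have "\<dots> = (\<Sum>j<n. (\<Sum>k<n. shift h z i k * G k j) * complex_of_real (v j))"
      by (simp add: sum_distrib_right)
    also have "\<dots> = (\<Sum>j<n. if i = j then complex_of_real (v j) else 0)"
      using G i by (intro sum.cong refl) (auto simp: is_resolvent_def)
    finally show ?thesis using i by simp
  qed
  then have "\<bar>Im z\<bar> * ?Y \<le> ?V"
    by (rule shift_bounded_below[OF h])
  then have Y: "?Y \<le> ?V / Im z" using z by (simp add: field_simps)
  have "cmod (\<Sum>i<n. \<Sum>j<n. complex_of_real (v i) * G i j * complex_of_real (v j)) =
      cmod (\<Sum>i<n. complex_of_real (v i) * y i)"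
    by (simp add: y_def sum_distrib_left mult.assoc)
  also have "\<dots> \<le> ?V * ?Y" by (rule norm_sum_mult_le_L2_set)
  also have "\<dots> \<le> ?V * (?V / Im z)" by (intro mult_left_mono Y L2_set_nonneg)
  also have "\<dots> = ?V\<^sup>2 / Im z" by (simp add: power2_eq_square)
  also have "?V\<^sup>2 = (\<Sum>i<n. (v i)\<^sup>2)" by (simp add: L2_set_def sum_nonneg)
  finally show ?thesis .
qed

text \<open>
  Both sides come from \<open>G' (H - H') G = G' (H - z) G - G' (H' - z) G\<close>.
\<close>

lemma resolvent_identity:
  assumes G: "is_resolvent n h z G" and G': "is_resolvent n h' z G'" and ab: "a < n" "b < n"
  shows "G' a b - G a b = (\<Sum>c<n. \<Sum>d<n. G' a c * complex_of_real (h c d - h' c d) * G d b)"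
proof -
  have 1: "(\<Sum>c<n. \<Sum>d<n. G' a c * shift h z c d * G d b) = G' a b"
  proof -
    have "(\<Sum>c<n. \<Sum>d<n. G' a c * shift h z c d * G d b) = (\<Sum>c<n. G' a c * (\<Sum>d<n. shift h z c d * G d b))"
      by (simp add: sum_distrib_left mult.assoc)
    also have "\<dots> = (\<Sum>c<n. if c = b then G' a c else 0)"
      using G ab by (intro sum.cong refl) (auto simp: is_resolvent_def)
    finally show ?thesis using ab by simp
  qed
  have 2: "(\<Sum>c<n. \<Sum>d<n. G' a c * shift h' z c d * G d b) = G a b"
  proof -
    have "(\<Sum>c<n. \<Sum>d<n. G' a c * shift h' z c d * G d b) = (\<Sum>d<n. \<Sum>c<n. G' a c * shift h' z c d * G d b)"
      by (rule sum.swap)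
    also have "\<dots> = (\<Sum>d<n. (\<Sum>c<n. G' a c * shift h' z c d) * G d b)"
      by (simp add: sum_distrib_right)
    also have "\<dots> = (\<Sum>d<n. if d = a then G d b else 0)"
      using G' ab by (intro sum.cong refl) (auto simp: is_resolvent_def)
    finally show ?thesis using ab by simp
  qed
  have "G' a b - G a b = (\<Sum>c<n. \<Sum>d<n. G' a c * shift h z c d * G d b - G' a c * shift h' z c d * G d b)"
    by (simp only: sum_subtractf 1 2)
  also have "\<dots> = (\<Sum>c<n. \<Sum>d<n. G' a c * complex_of_real (h c d - h' c d) * G d b)"
    by (intro sum.cong refl) (auto simp: shift_def algebra_simps)
  finally show ?thesis .
qed


lemma mat_energy_eq_sum_abs_roots:
  fixes es :: "real list"
  assumes "char_poly A = (\<Prod>e\<leftarrow>es. [:- e, 1:])"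
  shows "mat_energy A = (\<Sum>e\<leftarrow>es. \<bar>e\<bar>)"
proof -
  have "proots (\<Prod>e\<leftarrow>es. [:- e, 1:]) = mset es"
  proof (induction es)
    case (Cons e es)
    have "(\<Prod>e\<leftarrow>es. [:- e, 1:]) \<noteq> 0" by (auto simp: prod_list_zero_iff)
    then show ?case using Cons by (simp add: proots_mult del: mult_pCons_left)
  qed simp
  then show ?thesis
    unfolding mat_energy_def assms by (metis mset_map sum_mset_sum_list)
qed

lemma logarithmic_derivative_prod_list:
  fixes as :: "'a::field list"
  assumes "z \<notin> set as"
  shows "poly (pderiv (\<Prod>a\<leftarrow>as. [:- a, 1:])) z = poly (\<Prod>a\<leftarrow>as. [:- a, 1:]) z * (\<Sum>a\<leftarrow>as. 1 / (z - a))"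
  using assms
proof (induction as)
  case (Cons a as)
  have "poly (pderiv ([:- a, 1:] * (\<Prod>a\<leftarrow>as. [:- a, 1:]))) z =
     (z - a) * poly (pderiv (\<Prod>a\<leftarrow>as. [:- a, 1:])) z + poly (\<Prod>a\<leftarrow>as. [:- a, 1:]) z"
    by (simp add: pderiv_mult pderiv_pCons del: mult_pCons_left)
  also have "\<dots> = (z - a) * poly (\<Prod>a\<leftarrow>as. [:- a, 1:]) z * (1 / (z - a) + (\<Sum>a\<leftarrow>as. 1 / (z - a)))"
    using Cons by (simp add: distrib_left)
  finally show ?case by (simp del: mult_pCons_left)
qed simp

text \<open>
  The characteristic polynomial splits over the complex numbers and its roots are real by
  \<open>shift_bounded_below\<close>, so it already splits over the reals. Off the real axis the resolvent is the
  adjugate of \<open>z - H\<close> over its determinant, up to sign. Its diagonal entries are quotients of the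
  characteristic polynomials of the principal minors by that of \<open>H\<close>; the minors sum to the
  derivative, so the trace is a logarithmic derivative.
\<close>

lemma symmetric_resolvent_exists:
  assumes h: "symmetric_upto n h"
  obtains es :: "real list" where
    "length es = n"
    "char_poly (mat n n (\<lambda>(i, j). h i j)) = (\<Prod>e\<leftarrow>es. [:- e, 1:])"
    "\<And>z. Im z > 0 \<Longrightarrow> \<exists>G. is_resolvent n h z G \<and>
       (\<Sum>i<n. G i i) = (\<Sum>e\<leftarrow>es. 1 / (complex_of_real e - z))"
proof -
  let ?det = Determinant.det
  define A where "A = mat n n (\<lambda>(i, j). h i j)"
  have A: "A \<in> carrier_mat n n" by (simp add: A_def)
  define C where "C = map_mat complex_of_real A"
  have C: "C \<in> carrier_mat n n" using A by (simp add: C_def)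
  obtain as where as: "char_poly C = (\<Prod>a\<leftarrow>as. [:- a, 1:])" "length as = n"
    using char_poly_factorized[OF C] by blast
  have root: "poly (char_poly C) z = 0 \<longleftrightarrow> z \<in> set as" for z
    unfolding as by (induction as) auto
  have real: "Im a = 0" if "a \<in> set as" for a
  proof -
    have "eigenvalue C a" using root that eigenvalue_root_char_poly[OF C] by simp
    then obtain v where v: "v \<in> carrier_vec n" "v \<noteq> 0\<^sub>v n" "C *\<^sub>v v = a \<cdot>\<^sub>v v"
      using C by (auto simp: eigenvalue_def eigenvector_def)
    have "(\<Sum>k<n. shift h a i k * v $ k) = 0" if i: "i < n" for i
    proof -
      have "(C *\<^sub>v v) $ i = (\<Sum>k<n. complex_of_real (h i k) * v $ k)"
        using i v(1) by (simp add: C_def A_def scalar_prod_def atLeast0LessThan)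
      then show ?thesis using v i by (simp add: sum_shift)
    qed
    then have "\<bar>Im a\<bar> * L2_set (\<lambda>i. cmod (v $ i)) {..<n} \<le> L2_set (\<lambda>i. cmod 0) {..<n}"
      by (intro shift_bounded_below[OF h]) simp
    moreover have "L2_set (\<lambda>i. cmod (v $ i)) {..<n} \<noteq> 0"
      using v(1,2) by (auto simp: L2_set_eq_0_iff)
    ultimately show "Im a = 0"
      using L2_set_nonneg[of "\<lambda>i. cmod (v $ i)" "{..<n}"]
      by (simp add: L2_set_def mult_le_0_iff)
  qed
  define es where "es = map Re as"
  have as_es: "as = map complex_of_real es"
    unfolding es_def using real by (intro nth_equalityI) (auto simp: complex_eq_iff)
  have hom_mult: "map_poly complex_of_real (q * r) = map_poly complex_of_real q * map_poly complex_of_real r" for q r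
    by (intro poly_eqI) (simp add: coeff_map_poly coeff_mult)
  have "map_poly complex_of_real (char_poly A) = map_poly complex_of_real (\<Prod>e\<leftarrow>es. [:- e, 1:])"
  proof -
    have "map_poly complex_of_real (char_poly A) = char_poly C"
      unfolding C_def by (rule of_real_hom.char_poly_hom[OF A, symmetric])
    also have "\<dots> = map_poly complex_of_real (\<Prod>e\<leftarrow>es. [:- e, 1:])"
      unfolding as as_es by (induction es) (simp_all add: hom_mult of_real_hom.map_poly_pCons_hom del: mult_pCons_left)
    finally show ?thesis .
  qed
  then have char_poly: "char_poly A = (\<Prod>e\<leftarrow>es. [:- e, 1:])"
    by (auto simp: poly_eq_iff coeff_map_poly)
  have res: "\<exists>G. is_resolvent n h z G \<and> (\<Sum>i<n. G i i) = (\<Sum>e\<leftarrow>es. 1 / (complex_of_real e - z))"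
    if z: "Im z > 0" for z
  proof -
    define N where "N = - char_matrix C z"
    have N: "N \<in> carrier_mat n n" using C by (simp add: N_def)
    have N_shift: "N $$ (i, j) = - shift h z i j" if "i < n" "j < n" for i j
      using that by (simp add: N_def char_matrix_def C_def A_def shift_def)
    have det: "?det N = poly (char_poly C) z" unfolding N_def by (rule char_poly_matrix[OF C, symmetric])
    have z_as: "z \<notin> set as" using real z by force
    then have det0: "?det N \<noteq> 0" using root det by simp
    define G where "G i j = - adj_mat N $$ (i, j) / ?det N" for i j
    note adj = adj_mat[OF N]
    have "(\<Sum>k<n. shift h z i k * G k j) = (if i = j then 1 else 0)" if "i < n" "j < n" for i j
    proof -
      have "(N * adj_mat N) $$ (i, j) = (\<Sum>k<n. N $$ (i, k) * adj_mat N $$ (k, j))"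
        using that N adj(1) by (simp add: scalar_prod_def atLeast0LessThan)
      also have "\<dots> = (\<Sum>k<n. shift h z i k * G k j) * ?det N"
        using that det0 by (simp add: sum_distrib_right N_shift G_def)
      finally show ?thesis using that det0 by (auto simp: adj(2) split: if_splits)
    qed
    moreover have "(\<Sum>k<n. G i k * shift h z k j) = (if i = j then 1 else 0)" if "i < n" "j < n" for i j
    proof -
      have "(adj_mat N * N) $$ (i, j) = (\<Sum>k<n. adj_mat N $$ (i, k) * N $$ (k, j))"
        using that N adj(1) by (simp add: scalar_prod_def atLeast0LessThan)
      also have "\<dots> = (\<Sum>k<n. G i k * shift h z k j) * ?det N"
        using that det0 by (simp add: sum_distrib_right N_shift G_def)
      finally show ?thesis using that det0 by (auto simp: adj(3) split: if_splits)
    qed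
    ultimately have G: "is_resolvent n h z G" by (simp add: is_resolvent_def)
    have "adj_mat N $$ (i, i) = poly (char_poly (mat_delete C i i)) z" if i: "i < n" for i
    proof -
      have D: "mat_delete C i i \<in> carrier_mat (n - 1) (n - 1)" using C by (rule mat_delete_carrier)
      have "mat_delete N i i = - char_matrix (mat_delete C i i) z"
        using i by (intro eq_matI) (auto simp: N_def char_matrix_def mat_delete_def C_def A_def)
      then have "?det (mat_delete N i i) = poly (char_poly (mat_delete C i i)) z"
        by (simp add: char_poly_matrix[OF D])
      then show ?thesis
        using i N by (simp add: adj_mat_def cofactor_def)
    qed
    then have "(\<Sum>i<n. G i i) = - poly (pderiv (char_poly C)) z / poly (char_poly C) z"
      by (simp add: G_def det pderiv_char_poly[OF C] poly_sum sum_negf sum_divide_distrib)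
    also have "\<dots> = - (\<Sum>a\<leftarrow>as. 1 / (z - a))"
      using logarithmic_derivative_prod_list[OF z_as] det0 det by (simp add: as)
    also have "\<dots> = (\<Sum>e\<leftarrow>es. 1 / (complex_of_real e - z))"
      unfolding as_es by (simp add: uminus_sum_list_map o_def) (metis minus_diff_eq minus_divide_right)
    finally show ?thesis using G by blast
  qed
  show ?thesis
    by (rule that[of es]) (use char_poly res as in \<open>auto simp: A_def es_def\<close>)
qed


definition resolvent :: "nat \<Rightarrow> (nat \<Rightarrow> nat \<Rightarrow> real) \<Rightarrow> complex \<Rightarrow> nat \<Rightarrow> nat \<Rightarrow> complex" where
  "resolvent n h z = (SOME G. is_resolvent n h z G)"

lemma is_resolvent_resolvent:
  assumes "symmetric_upto n h" "Im z > 0"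
  shows "is_resolvent n h z (resolvent n h z)"
  unfolding resolvent_def using symmetric_resolvent_exists[OF assms(1)] assms(2) by (metis someI_ex)

lemma resolvent_unique:
  assumes "is_resolvent n h z G" "is_resolvent n h z G'" "a < n" "b < n"
  shows "G a b = G' a b"
  using resolvent_identity[OF assms(2,1,3,4)] by simp

text \<open>
  The transpose of a resolvent of a symmetric matrix is again a resolvent.
\<close>

lemma resolvent_row:
  assumes h: "symmetric_upto n h" and G: "is_resolvent n h z G" and z: "Im z > 0" and i: "i < n"
  shows "(\<Sum>j<n. (cmod (G i j))\<^sup>2) \<le> 1 / (Im z)\<^sup>2"
proof -
  have sh: "shift h z a b = shift h z b a" if "a < n" "b < n" for a b
    using h that by (auto simp: symmetric_upto_def shift_def)
  have "is_resolvent n h z (\<lambda>i j. G j i)"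
    using G unfolding is_resolvent_def by (simp add: sh mult.commute[of "G _ _"])
  from resolvent_column[OF h this z i] show ?thesis .
qed

definition stieltjes :: "nat \<Rightarrow> (nat \<Rightarrow> nat \<Rightarrow> real) \<Rightarrow> complex \<Rightarrow> complex" where
  "stieltjes n h z = (\<Sum>i<n. resolvent n h z i i) / of_nat n"

lemma stieltjes_eq_eigenvalue_sum:
  assumes h: "symmetric_upto n h"
  obtains es :: "real list" where
    "length es = n"
    "char_poly (mat n n (\<lambda>(i, j). h i j)) = (\<Prod>e\<leftarrow>es. [:- e, 1:])"
    "\<And>z. Im z > 0 \<Longrightarrow> stieltjes n h z = (\<Sum>e\<leftarrow>es. 1 / (complex_of_real e - z)) / of_nat n"
proof -
  obtain es where es: "length es = n"
    "char_poly (mat n n (\<lambda>(i, j). h i j)) = (\<Prod>e\<leftarrow>es. [:- e, 1:])"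
    "\<And>z. Im z > 0 \<Longrightarrow> \<exists>G. is_resolvent n h z G \<and>
       (\<Sum>i<n. G i i) = (\<Sum>e\<leftarrow>es. 1 / (complex_of_real e - z))"
    using symmetric_resolvent_exists[OF h] by blast
  have "stieltjes n h z = (\<Sum>e\<leftarrow>es. 1 / (complex_of_real e - z)) / of_nat n" if z: "Im z > 0" for z
  proof -
    obtain G where G: "is_resolvent n h z G" "(\<Sum>i<n. G i i) = (\<Sum>e\<leftarrow>es. 1 / (complex_of_real e - z))"
      using es(3)[OF z] by blast
    have "(\<Sum>i<n. resolvent n h z i i) = (\<Sum>i<n. G i i)"
      by (intro sum.cong refl resolvent_unique[OF is_resolvent_resolvent[OF h z] G(1)]) auto
    then show ?thesis by (simp add: stieltjes_def G(2))
  qed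
  with es(1,2) show ?thesis by (rule that)
qed

lemma mat_energy_scale:
  assumes h: "symmetric_upto n h" and c: "c > 0"
  shows "mat_energy (mat n n (\<lambda>(i, j). c * h i j)) = c * mat_energy (mat n n (\<lambda>(i, j). h i j))"
proof -
  define A where "A = mat n n (\<lambda>(i, j). h i j)"
  define B where "B = mat n n (\<lambda>(i, j). c * h i j)"
  have A: "A \<in> carrier_mat n n" and B: "B \<in> carrier_mat n n" by (simp_all add: A_def B_def)
  obtain es :: "real list" where es: "length es = n" "char_poly A = (\<Prod>e\<leftarrow>es. [:- e, 1:])"
    unfolding A_def using stieltjes_eq_eigenvalue_sum[OF h] by metis
  have "poly (char_poly B) t = poly (\<Prod>e\<leftarrow>map ((*) c) es. [:- e, 1:]) t" for t
  proof -
    have "- char_matrix B t = c \<cdot>\<^sub>m (- char_matrix A (t / c))"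
      using c by (intro eq_matI) (auto simp: char_matrix_def A_def B_def algebra_simps)
    then have "poly (char_poly B) t = c ^ n * poly (char_poly A) (t / c)"
      using char_matrix_closed[OF A, of "t / c"]
      by (simp add: char_poly_matrix[OF A] char_poly_matrix[OF B] det_smult)
    also have "\<dots> = (\<Prod>e\<leftarrow>es. t - c * e)"
      unfolding es(2) es(1)[symmetric] using c by (induction es) (auto simp: field_simps)
    also have "\<dots> = poly (\<Prod>e\<leftarrow>map ((*) c) es. [:- e, 1:]) t"
      by (induction es) (auto simp: algebra_simps)
    finally show ?thesis .
  qed
  then have "char_poly B = (\<Prod>e\<leftarrow>map ((*) c) es. [:- e, 1:])"
    by (simp add: poly_eq_poly_eq_iff[symmetric] fun_eq_iff)
  then have "mat_energy B = (\<Sum>e\<leftarrow>map ((*) c) es. \<bar>e\<bar>)" by (rule mat_energy_eq_sum_abs_roots)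
  also have "\<dots> = c * mat_energy A"
    unfolding mat_energy_eq_sum_abs_roots[OF es(2)] using c
    by (simp add: o_def abs_mult sum_list_const_mult)
  finally show ?thesis by (simp add: A_def B_def)
qed

section \<open>Functions of independent coins\<close>

abbreviation coin_pmf :: "'a set \<Rightarrow> real \<Rightarrow> ('a \<Rightarrow> bool) pmf" where
  "coin_pmf V p \<equiv> Pi_pmf V False (\<lambda>_. bernoulli_pmf p)"

lemma finite_set_coin_pmf: "finite V \<Longrightarrow> finite (set_pmf (coin_pmf V p))"
  by (rule finite_subset[OF set_Pi_pmf_subset']) auto

lemma integrable_coin_pmf:
  fixes f :: "('a \<Rightarrow> bool) \<Rightarrow> 'b :: {banach, second_countable_topology}"
  assumes "finite V"
  shows "integrable (measure_pmf (coin_pmf V p)) f"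
  by (rule integrable_measure_pmf_finite[OF finite_set_coin_pmf[OF assms]])

lemma expectation_coin_insert:
  fixes f :: "('a \<Rightarrow> bool) \<Rightarrow> 'b :: {banach, second_countable_topology, real_normed_field}"
  assumes V: "finite V" and e: "e \<notin> V" and p: "0 \<le> p" "p \<le> 1"
  shows "measure_pmf.expectation (coin_pmf (insert e V) p) f =
    measure_pmf.expectation (coin_pmf V p)
      (\<lambda>X. of_real p * f (X(e := True)) + of_real (1 - p) * f (X(e := False)))"
proof -
  have "coin_pmf (insert e V) p =
    coin_pmf V p \<bind> (\<lambda>X. map_pmf (\<lambda>b. X(e := b)) (bernoulli_pmf p))"
    unfolding Pi_pmf_insert[OF V e] pair_pmf_def map_pmf_def
    by (subst bind_commute_pmf) (simp add: bind_assoc_pmf bind_return_pmf)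
  moreover have "measure_pmf.expectation (bernoulli_pmf p) g = of_real p * g True + of_real (1 - p) * g False"
    for g :: "bool \<Rightarrow> 'b"
    using p by (subst integral_measure_pmf[of UNIV]) (auto simp: UNIV_bool scaleR_conv_of_real)
  ultimately show ?thesis
    using V
    by (simp add: pmf_expectation_bind[where A = "set_pmf (coin_pmf V p)"] finite_set_coin_pmf
        integral_measure_pmf[OF finite_set_coin_pmf[OF V]] mult.commute scaleR_conv_of_real)
qed


text \<open>
  Tossing the coin \<open>e\<close> once more does not change the distribution.
\<close>

lemma expectation_coin_split:
  fixes f :: "('a \<Rightarrow> bool) \<Rightarrow> 'b :: {banach, second_countable_topology, real_normed_field}"
  assumes V: "finite V" and e: "e \<in> V" and p: "0 \<le> p" "p \<le> 1"
  shows "measure_pmf.expectation (coin_pmf V p) f =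
    measure_pmf.expectation (coin_pmf V p)
      (\<lambda>X. of_real p * f (X(e := True)) + of_real (1 - p) * f (X(e := False)))"
proof -
  define W where "W = V - {e}"
  have W: "V = insert e W" "finite W" "e \<notin> W" using V e by (auto simp: W_def)
  show ?thesis
    unfolding W(1) expectation_coin_insert[OF W(2,3) p] by (simp add: algebra_simps)
qed

lemma expectation_coin_mono:
  fixes f g :: "('a \<Rightarrow> bool) \<Rightarrow> real"
  assumes "finite V" "\<And>X. f X \<le> g X"
  shows "measure_pmf.expectation (coin_pmf V p) f \<le> measure_pmf.expectation (coin_pmf V p) g"
  by (intro integral_mono integrable_coin_pmf assms)

lemma norm_expectation_coin_le:
  fixes f :: "('a \<Rightarrow> bool) \<Rightarrow> complex"
  assumes V: "finite V" and "\<And>X. cmod (f X) \<le> c"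
  shows "cmod (measure_pmf.expectation (coin_pmf V p) f) \<le> c"
proof -
  have "cmod (measure_pmf.expectation (coin_pmf V p) f) \<le> measure_pmf.expectation (coin_pmf V p) (\<lambda>X. cmod (f X))"
    by (rule integral_norm_bound)
  also have "\<dots> \<le> measure_pmf.expectation (coin_pmf V p) (\<lambda>_. c)"
    using assms by (intro expectation_coin_mono) auto
  finally show ?thesis by simp
qed

lemma expectation_coin_of_real:
  fixes f :: "('a \<Rightarrow> bool) \<Rightarrow> real"
  shows "measure_pmf.expectation (coin_pmf V p) (\<lambda>X. complex_of_real (f X)) =
    of_real (measure_pmf.expectation (coin_pmf V p) f)"
  by simp

lemma two_point_variance:
  fixes a b m :: complex
  shows "p * (cmod (a - m))\<^sup>2 + (1 - p) * (cmod (b - m))\<^sup>2 =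
    (cmod (of_real p * a + of_real (1 - p) * b - m))\<^sup>2 + p * (1 - p) * (cmod (a - b))\<^sup>2"
  unfolding cmod_power2 by (simp add: power2_eq_square algebra_simps)

text \<open>
  The Efron-Stein inequality for bounded differences. Averaging over one coin splits the variance
  into the variance of the average, whose differences in the other coins obey the same bound, and
  the mean of a two-point variance, which is at most the squared difference.
\<close>

lemma coin_variance_bound:
  fixes f :: "('a \<Rightarrow> bool) \<Rightarrow> complex"
  assumes V: "finite V" and p: "0 \<le> p" "p \<le> 1"
    and "\<And>e X. e \<in> V \<Longrightarrow> cmod (f (X(e := True)) - f (X(e := False))) \<le> c"
  shows "measure_pmf.expectation (coin_pmf V p)
      (\<lambda>X. (cmod (f X - measure_pmf.expectation (coin_pmf V p) f))\<^sup>2) \<le> real (card V) * c\<^sup>2"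
  using V assms(4)
proof (induction V arbitrary: f)
  case empty
  then show ?case by simp
next
  case (insert e V)
  let ?E = "\<lambda>V. measure_pmf.expectation (coin_pmf V p)"
  define g where "g X = of_real p * f (X(e := True)) + of_real (1 - p) * f (X(e := False))" for X
  define m where "m = measure_pmf.expectation (coin_pmf V p) g"
  have m: "measure_pmf.expectation (coin_pmf (insert e V) p) f = m"
    unfolding m_def g_def by (rule expectation_coin_insert[OF insert.hyps p])
  have g: "cmod (g (X(i := True)) - g (X(i := False))) \<le> c" if i: "i \<in> V" for i X
  proof -
    have ne: "i \<noteq> e" using i insert.hyps by auto
    have "g (X(i := True)) - g (X(i := False)) =
      of_real p * (f ((X(e := True))(i := True)) - f ((X(e := True))(i := False))) +
      of_real (1 - p) * (f ((X(e := False))(i := True)) - f ((X(e := False))(i := False)))"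
      unfolding g_def fun_upd_twist[OF ne] by (simp add: algebra_simps)
    also have "cmod \<dots> \<le> p * c + (1 - p) * c"
      using p i by (intro norm_triangle_le add_mono)
        (auto simp: norm_mult simp flip: of_real_diff intro!: mult_left_mono insert.prems simp del: of_real_diff)
    finally show ?thesis by (simp add: algebra_simps)
  qed
  have "complex_of_real (measure_pmf.expectation (coin_pmf (insert e V) p) (\<lambda>X. (cmod (f X - m))\<^sup>2)) =
    of_real (measure_pmf.expectation (coin_pmf V p)
      (\<lambda>X. p * (cmod (f (X(e := True)) - m))\<^sup>2 + (1 - p) * (cmod (f (X(e := False)) - m))\<^sup>2))"
    unfolding expectation_coin_of_real[symmetric] expectation_coin_insert[OF insert.hyps p]
    by simp
  then have "measure_pmf.expectation (coin_pmf (insert e V) p) (\<lambda>X. (cmod (f X - m))\<^sup>2) =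
    measure_pmf.expectation (coin_pmf V p)
      (\<lambda>X. p * (cmod (f (X(e := True)) - m))\<^sup>2 + (1 - p) * (cmod (f (X(e := False)) - m))\<^sup>2)"
    by (simp only: of_real_eq_iff)
  also have "\<dots> \<le> measure_pmf.expectation (coin_pmf V p) (\<lambda>X. (cmod (g X - m))\<^sup>2 + c\<^sup>2)"
  proof (rule expectation_coin_mono[OF insert.hyps(1)])
    fix X
    have "cmod (f (X(e := True)) - f (X(e := False))) \<le> c" by (rule insert.prems) simp
    then have "p * (1 - p) * (cmod (f (X(e := True)) - f (X(e := False))))\<^sup>2 \<le> 1 * c\<^sup>2"
      by (intro mult_mono power_mono mult_le_one) (use p in auto)
    then show "p * (cmod (f (X(e := True)) - m))\<^sup>2 + (1 - p) * (cmod (f (X(e := False)) - m))\<^sup>2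
        \<le> (cmod (g X - m))\<^sup>2 + c\<^sup>2"
      unfolding two_point_variance g_def by simp
  qed
  also have "\<dots> = measure_pmf.expectation (coin_pmf V p) (\<lambda>X. (cmod (g X - m))\<^sup>2) + c\<^sup>2"
    by (subst Bochner_Integration.integral_add) (auto intro: integrable_coin_pmf insert.hyps)
  also have "\<dots> \<le> real (card V) * c\<^sup>2 + c\<^sup>2"
    using insert.IH[of g, OF g] by (simp add: m_def)
  also have "\<dots> = real (card (insert e V)) * c\<^sup>2"
    using insert.hyps by (simp add: algebra_simps)
  finally show ?case unfolding m .
qed

text \<open>
  A function of one coin has only two values, so Stein's formula holds without a remainder.
\<close>

lemma coin_integration_by_parts:
  fixes f :: "('a \<Rightarrow> bool) \<Rightarrow> complex" and w :: "bool \<Rightarrow> real"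
  assumes V: "finite V" and e: "e \<in> V" and p: "0 \<le> p" "p \<le> 1"
  shows "measure_pmf.expectation (coin_pmf V p) (\<lambda>X. of_real (w (X e)) * f X) =
    of_real (p * w True + (1 - p) * w False) * measure_pmf.expectation (coin_pmf V p) f +
    of_real (p * (1 - p) * (w True - w False)) *
      measure_pmf.expectation (coin_pmf V p) (\<lambda>X. f (X(e := True)) - f (X(e := False)))"
proof -
  let ?E = "measure_pmf.expectation (coin_pmf V p)"
  note I = integrable_coin_pmf[OF V]
  have "?E (\<lambda>X. of_real (w (X e)) * f X) =
    ?E (\<lambda>X. of_real p * (of_real (w True) * f (X(e := True))) + of_real (1 - p) * (of_real (w False) * f (X(e := False))))"
    by (subst expectation_coin_split[OF V e p]) simp
  also have "\<dots> = ?E (\<lambda>X. of_real (p * w True + (1 - p) * w False) *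
        (of_real p * f (X(e := True)) + of_real (1 - p) * f (X(e := False))) +
     of_real (p * (1 - p) * (w True - w False)) * (f (X(e := True)) - f (X(e := False))))"
    by (simp add: algebra_simps)
  also have "\<dots> = of_real (p * w True + (1 - p) * w False) *
      ?E (\<lambda>X. of_real p * f (X(e := True)) + of_real (1 - p) * f (X(e := False))) +
     of_real (p * (1 - p) * (w True - w False)) * ?E (\<lambda>X. f (X(e := True)) - f (X(e := False)))"
    by (simp only: Bochner_Integration.integral_add[OF I I] integral_mult_right_zero)
  also have "?E (\<lambda>X. of_real p * f (X(e := True)) + of_real (1 - p) * f (X(e := False))) = ?E f"
    by (rule expectation_coin_split[OF V e p, symmetric])
  finally show ?thesis .
qed


text \<open>
  For \<open>a w = {u, w}\<close> and \<open>b w = {w, v}\<close> the product is the indicator that \<open>u\<close> and \<open>v\<close> have no common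
  neighbour.
\<close>

lemma expectation_coin_prod_pairs:
  fixes a b :: "'i \<Rightarrow> 'a"
  assumes V: "finite V" and p: "0 \<le> p" "p \<le> 1" and W: "finite W"
    and "a ` W \<subseteq> V" "b ` W \<subseteq> V" "inj_on a W" "inj_on b W" "a ` W \<inter> b ` W = {}"
  shows "measure_pmf.expectation (coin_pmf V p) (\<lambda>X. \<Prod>w\<in>W. 1 - of_bool (X (a w) \<and> X (b w))) = (1 - p\<^sup>2) ^ card W"
  using W assms(5-)
proof (induction W)
  case (insert w W)
  let ?E = "measure_pmf.expectation (coin_pmf V p)"
  define R where "R X = (\<Prod>w\<in>W. 1 - of_bool (X (a w) \<and> X (b w)) :: real)" for X
  have fresh: "a v \<noteq> e \<and> b v \<noteq> e" if "e = a w \<or> e = b w" "v \<in> W" for e v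
  proof -
    have "v \<noteq> w" using that insert.hyps by blast
    then have "a v \<noteq> a w" "b v \<noteq> b w"
      using insert.prems(3,4) that(2) by (meson inj_onD insertCI)+
    moreover have "a v \<noteq> b w" "b v \<noteq> a w"
      using insert.prems(5) that(2) by (metis disjoint_iff imageI insertCI)+
    ultimately show ?thesis using that(1) by blast
  qed
  have R: "R (X(e := c)) = R X" if "e = a w \<or> e = b w" for X e c
    unfolding R_def by (rule prod.cong[OF refl]) (simp add: fresh[OF that])
  have ne: "b w \<noteq> a w" using insert.prems(5) by (metis disjoint_iff imageI insertCI)
  have wV: "a w \<in> V" "b w \<in> V" using insert.prems(1,2) by auto
  have "?E (\<lambda>X. \<Prod>w\<in>insert w W. 1 - of_bool (X (a w) \<and> X (b w))) =
      ?E (\<lambda>X. (1 - of_bool (X (a w) \<and> X (b w))) * R X)"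
    using insert.hyps by (simp add: R_def)
  also have "\<dots> = ?E (\<lambda>X. p * ((1 - of_bool (X (b w))) * R X) + (1 - p) * R X)"
    by (rule trans[OF expectation_coin_split[OF V wV(1) p]], rule Bochner_Integration.integral_cong[OF refl])
       (simp add: R ne)
  also have "\<dots> = ?E (\<lambda>X. (1 - p\<^sup>2) * R X)"
  proof (rule trans[OF expectation_coin_split[OF V wV(2) p]], rule Bochner_Integration.integral_cong[OF refl])
    fix X
    have "p * ((1 - p) * R X) + (1 - p) * (p * R X + (1 - p) * R X) = (1 - p\<^sup>2) * R X"
      by (simp add: algebra_simps power2_eq_square)
    then show "of_real p * (p * ((1 - of_bool ((X(b w := True)) (b w))) * R (X(b w := True))) + (1 - p) * R (X(b w := True))) +
        of_real (1 - p) * (p * ((1 - of_bool ((X(b w := False)) (b w))) * R (X(b w := False))) + (1 - p) * R (X(b w := False))) =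
        (1 - p\<^sup>2) * R X"
      by (simp add: R)
  qed
  also have "\<dots> = (1 - p\<^sup>2) * (1 - p\<^sup>2) ^ card W"
  proof -
    have "?E R = (1 - p\<^sup>2) ^ card W"
      unfolding R_def using insert.prems(3-5) by (intro insert.IH) (use insert.prems(1,2) in \<open>auto simp: inj_on_insert\<close>)
    then show ?thesis by simp
  qed
  finally show ?case using insert.hyps by simp
qed simp

section \<open>Coulson's integral and the semicircle law\<close>

lemma has_bochner_integral_FTC_greaterThan:
  fixes f F :: "real \<Rightarrow> real"
  assumes f: "f \<in> borel_measurable borel"
    and deriv: "\<And>x. a \<le> x \<Longrightarrow> (F has_real_derivative f x) (at x)"
    and nonneg: "\<And>x. a \<le> x \<Longrightarrow> 0 \<le> f x"
    and lim: "(F \<longlongrightarrow> T) at_top"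
  shows "has_bochner_integral lborel (\<lambda>x. indicator {a<..} x * f x) (T - F a)"
proof (rule has_bochner_integral_nn_integral)
  have "F a \<le> F x" if "a \<le> x" for x
    using that deriv nonneg by (intro DERIV_nonneg_imp_nondecreasing[of a x F]) auto
  then show "0 \<le> T - F a"
    using tendsto_lowerbound[OF lim, of "F a"] by (auto simp: eventually_at_top_linorder)
  have "(\<integral>\<^sup>+x. ennreal (indicator {a<..} x * f x) \<partial>lborel) = (\<integral>\<^sup>+x. ennreal (f x) * indicator {a..} x \<partial>lborel)"
    by (rule nn_integral_cong_AE, use AE_lborel_singleton[of a] in eventually_elim) (auto split: split_indicator)
  then show "(\<integral>\<^sup>+x. ennreal (indicator {a<..} x * f x) \<partial>lborel) = ennreal (T - F a)"
    using nn_integral_FTC_atLeast[OF f deriv nonneg lim] by simp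
qed (use f nonneg in \<open>auto split: split_indicator\<close>)

text \<open>
  The antiderivative is \<open>\<bar>e\<bar> arctan (x / \<bar>e\<bar>)\<close>.
\<close>

lemma Coulson_integral_abs:
  fixes e :: real
  shows "has_bochner_integral lborel (\<lambda>x. indicator {0<..} x * (e\<^sup>2 / (e\<^sup>2 + x\<^sup>2))) (pi / 2 * \<bar>e\<bar>)"
proof (cases "e = 0")
  case True
  then show ?thesis by (simp add: has_bochner_integral_zero)
next
  case False
  have "((\<lambda>x. \<bar>e\<bar> * arctan (x / \<bar>e\<bar>)) \<longlongrightarrow> \<bar>e\<bar> * (pi / 2)) at_top"
    using False
    by (intro tendsto_mult tendsto_const filterlim_compose[OF tendsto_arctan_at_top]
        filterlim_tendsto_pos_mult_at_top[OF tendsto_const, of "1 / \<bar>e\<bar>", simplified] filterlim_ident) auto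
  moreover have "((\<lambda>x. \<bar>e\<bar> * arctan (x / \<bar>e\<bar>)) has_real_derivative e\<^sup>2 / (e\<^sup>2 + x\<^sup>2)) (at x)" for x
    using False
    by (auto intro!: derivative_eq_intros simp: field_simps power2_eq_square)
  ultimately have "has_bochner_integral lborel (\<lambda>x. indicator {0<..} x * (e\<^sup>2 / (e\<^sup>2 + x\<^sup>2)))
      (\<bar>e\<bar> * (pi / 2) - \<bar>e\<bar> * arctan (0 / \<bar>e\<bar>))"
    by (intro has_bochner_integral_FTC_greaterThan) auto
  then show ?thesis by (simp add: mult_ac)
qed

text \<open>
  The Stieltjes transform of the semicircle law of variance \<open>s\<^sup>2\<close> is purely imaginary at \<open>i x\<close>;
  this is its imaginary part there.
\<close>

definition semicircle_im :: "real \<Rightarrow> real \<Rightarrow> real" where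
  "semicircle_im s x = (sqrt (x\<^sup>2 + 4 * s\<^sup>2) - x) / (2 * s\<^sup>2)"

lemma semicircle_im_eq:
  assumes "s > 0"
  shows "s\<^sup>2 * (semicircle_im s x)\<^sup>2 + x * semicircle_im s x = 1"
proof -
  define r where "r = sqrt (x\<^sup>2 + 4 * s\<^sup>2)"
  have r: "r\<^sup>2 = x\<^sup>2 + 4 * s\<^sup>2" by (simp add: r_def)
  have "s\<^sup>2 * (semicircle_im s x)\<^sup>2 + x * semicircle_im s x = (r\<^sup>2 - x\<^sup>2) / (4 * s\<^sup>2)"
    using assms unfolding semicircle_im_def r_def[symmetric]
    by (simp add: field_simps power2_eq_square)
  then show ?thesis using assms by (simp add: r)
qed

lemma semicircle_im_pos: "s > 0 \<Longrightarrow> semicircle_im s x > 0"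
  unfolding semicircle_im_def by (intro divide_pos_pos) (auto simp: real_less_rsqrt)

lemma semicircle_im_bound:
  assumes "s > 0" "x > 0"
  shows "1 - x * semicircle_im s x \<in> {0..min 1 (s\<^sup>2 / x\<^sup>2)}"
proof -
  let ?g = "semicircle_im s x"
  have g: "?g > 0" using semicircle_im_pos[OF assms(1)] .
  have eq: "1 - x * ?g = s\<^sup>2 * ?g\<^sup>2" using semicircle_im_eq[OF assms(1), of x] by simp
  then have "x * ?g \<le> 1" using zero_le_power2[of "s * ?g"] by (simp only: power_mult_distrib)
  then have "?g \<le> 1 / x" using assms by (simp add: field_simps)
  then have "s\<^sup>2 * ?g\<^sup>2 \<le> s\<^sup>2 * (1 / x)\<^sup>2" using g by (intro mult_left_mono power_mono) auto
  moreover have "1 - x * ?g \<le> 1" "0 \<le> 1 - x * ?g" using g assms \<open>x * ?g \<le> 1\<close> by simp_all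
  ultimately show ?thesis using eq by (simp add: power_divide)
qed

lemma semicircle_integral:
  assumes s: "s > 0"
  shows "has_bochner_integral lborel (\<lambda>x. indicator {0<..} x * (1 - x * semicircle_im s x)) (4 * s / 3)"
proof -
  define F where "F x = x - ((x\<^sup>2 + 4 * s\<^sup>2) * sqrt (x\<^sup>2 + 4 * s\<^sup>2) - x ^ 3) / (6 * s\<^sup>2)" for x :: real
  have pos: "x\<^sup>2 + 4 * s\<^sup>2 > 0" for x using s by (simp add: add_nonneg_pos)
  have "(F has_real_derivative 1 - x * semicircle_im s x) (at x)" for x
  proof -
    define r where "r = sqrt (x\<^sup>2 + 4 * s\<^sup>2)"
    have r: "r > 0" "x\<^sup>2 + 4 * s\<^sup>2 = r * r" using pos[of x] by (simp_all add: r_def)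
    have *: "1 - x * ((r - x) / (2 * s\<^sup>2)) =
        1 - (2 * x * r + (x\<^sup>2 + 4 * s\<^sup>2) * (x / r) - 3 * x\<^sup>2) / (6 * s\<^sup>2)"
      unfolding r(2) using s r(1) by (simp add: field_simps power2_eq_square)
    have "((\<lambda>x. sqrt (x\<^sup>2 + 4 * s\<^sup>2)) has_real_derivative inverse r / 2 * (2 * x)) (at x)"
      unfolding r_def
      by (rule DERIV_chain2[where f = sqrt and g = "\<lambda>x. x\<^sup>2 + 4 * s\<^sup>2", OF DERIV_real_sqrt[OF pos]])
         (auto intro!: derivative_eq_intros)
    moreover define q where "q = (\<lambda>x. sqrt (x\<^sup>2 + 4 * s\<^sup>2))"
    ultimately have q: "(q has_real_derivative x / q x) (at x)"
      by (simp add: r_def q_def field_simps)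
    have "(F has_real_derivative 1 - (2 * x * q x + x / q x * (x\<^sup>2 + 4 * s\<^sup>2) - 3 * x\<^sup>2) / (6 * s\<^sup>2)) (at x)"
      unfolding F_def fun_cong[OF q_def, symmetric]
      by (rule derivative_eq_intros q refl | (use s in force))+
         (use s in \<open>simp add: field_simps power2_eq_square\<close>)
    then show ?thesis
      unfolding semicircle_im_def r_def[symmetric] * by (simp add: q_def r_def mult_ac)
  qed
  moreover have "1 - x * semicircle_im s x \<ge> 0" if "0 \<le> x" for x
    using semicircle_im_bound[OF s, of x] that by (cases "x = 0") auto
  moreover have "(F \<longlongrightarrow> 0) at_top"
    unfolding F_def using s by real_asymp
  ultimately have "has_bochner_integral lborel (\<lambda>x. indicator {0<..} x * (1 - x * semicircle_im s x)) (0 - F 0)"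
    by (intro has_bochner_integral_FTC_greaterThan) (auto simp: semicircle_im_def)
  also have "0 - F 0 = 4 * s / 3"
    using s by (simp add: F_def real_sqrt_mult field_simps power2_eq_square)
  finally show ?thesis .
qed

section \<open>Graphs of diameter two\<close>

lemma wf_graph_of: "wf_digraph (with_proj (graph_of n X))"
  by unfold_locales (auto simp: with_proj_def graph_of_def vertex_pairs_def)

lemma pair_mem_vertex_pairs: "{u, v} \<in> vertex_pairs n \<longleftrightarrow> u < n \<and> v < n \<and> u \<noteq> v"
  by (auto simp: vertex_pairs_def card_insert_if)

lemma awalk_cost_one: "wf_digraph.awalk_cost (\<lambda>_. 1) q = real (length (q :: (nat \<times> nat) list))"
  by (induction q) (simp_all add: wf_digraph.awalk_cost_Nil[OF wf_graph_of] wf_digraph.awalk_cost_Cons[OF wf_graph_of])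

lemma awalk_graph_of:
  "pre_digraph.awalk (with_proj (graph_of n X)) u q v \<longleftrightarrow>
     u < n \<and> (\<forall>(a, b)\<in>set q. a < n \<and> b < n \<and> a \<noteq> b \<and> X {a, b}) \<and> pre_digraph.cas (with_proj (graph_of n X)) u q v"
  by (auto simp: pre_digraph.awalk_def graph_of_def with_proj_def pair_mem_vertex_pairs)

lemma cas_graph_of:
  "pre_digraph.cas (with_proj (graph_of n X)) u [] v \<longleftrightarrow> u = v"
  "pre_digraph.cas (with_proj (graph_of n X)) u (e # q) v \<longleftrightarrow>
     fst e = u \<and> pre_digraph.cas (with_proj (graph_of n X)) (snd e) q v"
  by (simp_all add: pre_digraph.cas.simps with_proj_def)

lemma graph_dist_le:
  assumes "pre_digraph.awalk (with_proj (graph_of n X)) u q v"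
  shows "graph_dist (graph_of n X) u v \<le> ereal (length q)"
  unfolding graph_dist_def
  using wf_digraph.min_cost_le_walk_cost[OF wf_graph_of assms, of "\<lambda>_. 1"]
  by (simp add: awalk_cost_one)

lemma graph_dist_ge:
  assumes "\<And>q. pre_digraph.awalk (with_proj (graph_of n X)) u q v \<Longrightarrow> k \<le> length q"
  shows "ereal k \<le> graph_dist (graph_of n X) u v"
  unfolding graph_dist_def wf_digraph.\<mu>_def[OF wf_graph_of]
  by (intro INF_greatest) (use assms in \<open>auto simp: awalk_cost_one\<close>)

text \<open>
  The walks of length 0, 1 and 2 give the upper bounds; for the lower bounds a walk with no arc joins
  a vertex to itself and a walk with one arc joins adjacent vertices.
\<close>

lemma graph_dist_common_neighbour:
  assumes uv: "u < n" "v < n"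
    and cn: "u \<noteq> v \<Longrightarrow> \<exists>w<n. w \<noteq> u \<and> w \<noteq> v \<and> X {u, w} \<and> X {w, v}"
  shows "graph_dist (graph_of n X) u v = ereal (if u = v then 0 else if X {u, v} then 1 else 2)"
proof (rule antisym)
  let ?d = "if u = v then 0 else if X {u, v} then 1 else 2 :: nat"
  have "\<exists>q. pre_digraph.awalk (with_proj (graph_of n X)) u q v \<and> length q = ?d"
  proof (cases "u = v \<or> X {u, v}")
    case True
    then show ?thesis
      using uv by (intro exI[of _ "if u = v then [] else [(u, v)]"]) (auto simp: awalk_graph_of cas_graph_of)
  next
    case False
    then obtain w where "w < n" "w \<noteq> u" "w \<noteq> v" "X {u, w}" "X {w, v}" using cn by auto
    with uv False show ?thesis
      by (intro exI[of _ "[(u, w), (w, v)]"]) (auto simp: awalk_graph_of cas_graph_of)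
  qed
  then show "graph_dist (graph_of n X) u v \<le> ereal (if u = v then 0 else if X {u, v} then 1 else 2)"
    using graph_dist_le by fastforce
  have "?d \<le> length q" if "pre_digraph.awalk (with_proj (graph_of n X)) u q v" for q
    using that
    by (cases q rule: remdups_adj.cases) (auto simp: awalk_graph_of cas_graph_of)
  then have "ereal (real ?d) \<le> graph_dist (graph_of n X) u v" by (rule graph_dist_ge)
  then show "ereal (if u = v then 0 else if X {u, v} then 1 else 2) \<le> graph_dist (graph_of n X) u v"
    by (simp split: if_splits)
qed

lemma rcw_matrix_diameter_two:
  assumes cn: "\<And>u v. u < n \<Longrightarrow> v < n \<Longrightarrow> u \<noteq> v \<Longrightarrow> \<exists>w<n. w \<noteq> u \<and> w \<noteq> v \<and> X {u, w} \<and> X {w, v}"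
    and nc: "\<exists>u<n. \<exists>v<n. u \<noteq> v \<and> \<not> X {u, v}"
  shows "rcw_matrix (graph_of n X) = mat n n (\<lambda>(i, j). if i = j then 0 else if X {i, j} then 1/2 else 1)"
proof -
  have verts: "pverts (graph_of n X) = {0..<n}" by (simp add: graph_of_def)
  note dist = graph_dist_common_neighbour[OF _ _ cn]
  obtain a b where ab: "a < n" "b < n" "a \<noteq> b" "\<not> X {a, b}" using nc by auto
  have "graph_diameter (graph_of n X) = ereal 2"
  proof (rule antisym)
    show "graph_diameter (graph_of n X) \<le> ereal 2"
      unfolding graph_diameter_def by (intro SUP_least) (auto simp: verts dist)
    have "ereal 2 = graph_dist (graph_of n X) a b" using ab by (simp add: dist)
    then show "ereal 2 \<le> graph_diameter (graph_of n X)"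
      unfolding graph_diameter_def using ab
      by (intro SUP_upper2[of a] SUP_upper2[of b]) (auto simp: verts)
  qed
  then show ?thesis
    by (intro eq_matI) (auto simp: rcw_matrix_def verts dist one_ereal_def)
qed

section \<open>The loop equation of the random weight matrix\<close>

lemma finite_vertex_pairs [simp]: "finite (vertex_pairs n)"
  by (rule finite_subset[of _ "Pow {0..<n}"]) (auto simp: vertex_pairs_def)

lemma card_vertex_pairs: "card (vertex_pairs n) = n choose 2"
  using n_subsets[of "{0..<n}" 2] by (simp add: vertex_pairs_def)

lemma card_vertex_pairs_le: "real (card (vertex_pairs n)) \<le> (real n)\<^sup>2"
proof -
  have "n choose 2 \<le> n * n" by (simp add: choose_two div_le_mono le_trans[OF div_le_dividend])
  then show ?thesis
    unfolding card_vertex_pairs power2_eq_square by (metis of_nat_le_iff of_nat_mult)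
qed

text \<open>
  The matrix entry at a pair of distinct vertices of a graph of diameter two.
\<close>

definition edge_weight :: "bool \<Rightarrow> real" where
  "edge_weight b = (if b then 1/2 else 1)"

definition normalized_weights :: "nat \<Rightarrow> (nat set \<Rightarrow> bool) \<Rightarrow> nat \<Rightarrow> nat \<Rightarrow> real" where
  "normalized_weights n X i j = (if i = j then 0 else edge_weight (X {i, j}) / sqrt n)"

lemma symmetric_normalized_weights: "symmetric_upto n (normalized_weights n X)"
  by (simp add: symmetric_upto_def normalized_weights_def insert_commute)

lemma normalized_weights_sq_le: "(normalized_weights n X i j)\<^sup>2 \<le> 1 / n"
  by (simp add: normalized_weights_def edge_weight_def power_divide divide_right_mono)

text \<open>
  The spectral parameter \<open>i x\<close> is fixed in this locale, and all error bounds are explicit in \<open>n\<close> and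
  \<open>x\<close>.
\<close>

locale weighted_random_matrix =
  fixes n :: nat and p x :: real
  assumes n: "n > 0" and p01: "0 < p" "p < 1" and x: "x > 0"
begin

lemma p: "0 \<le> p" "p \<le> 1" using p01 by auto

abbreviation E :: "((nat set \<Rightarrow> bool) \<Rightarrow> 'b) \<Rightarrow> 'b :: {banach, second_countable_topology}" where
  "E f \<equiv> measure_pmf.expectation (coin_pmf (vertex_pairs n) p) f"

definition z where "z = Complex 0 x"

lemma z: "Im z = x" "Re z = 0" "z = \<i> * x" "cmod z = x"
  using x by (auto simp: z_def complex_eq_iff norm_complex_def)

abbreviation h where "h \<equiv> normalized_weights n"

definition G where "G X = resolvent n (h X) z"
definition s where "s X = stieltjes n (h X) z"
definition m where "m = E s"

lemma s_eq: "s X = (\<Sum>i<n. G X i i) / of_nat n"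
  by (simp add: s_def G_def stieltjes_def)

lemma G_resolvent: "is_resolvent n (h X) z (G X)"
  unfolding G_def by (rule is_resolvent_resolvent[OF symmetric_normalized_weights]) (simp add: z x)

lemma G_entry: "i < n \<Longrightarrow> j < n \<Longrightarrow> cmod (G X i j) \<le> 1 / x"
  using resolvent_entry[OF symmetric_normalized_weights G_resolvent] by (simp add: z x)

lemma G_column: "j < n \<Longrightarrow> (\<Sum>i<n. (cmod (G X i j))\<^sup>2) \<le> 1 / x\<^sup>2"
  using resolvent_column[OF symmetric_normalized_weights G_resolvent] by (simp add: z x)

lemma G_row: "i < n \<Longrightarrow> (\<Sum>j<n. (cmod (G X i j))\<^sup>2) \<le> 1 / x\<^sup>2"
  using resolvent_row[OF symmetric_normalized_weights G_resolvent] by (simp add: z x)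

lemma G_quadratic_form:
  "cmod (\<Sum>i<n. \<Sum>j<n. complex_of_real (v i) * G X i j * complex_of_real (v j)) \<le> (\<Sum>i<n. (v i)\<^sup>2) / x"
  using resolvent_quadratic_form[OF symmetric_normalized_weights G_resolvent] by (simp add: z x)

lemma G_right:
  assumes "i < n" "j < n"
  shows "(\<Sum>k<n. of_real (h X i k) * G X k j) = (if i = j then 1 else 0) + z * G X i j"
proof -
  have "(\<Sum>k<n. shift (h X) z i k * G X k j) = (if i = j then 1 else 0)"
    using G_resolvent[of X] assms unfolding is_resolvent_def by blast
  then show ?thesis unfolding sum_shift(1)[OF assms(1)] by (simp only: diff_eq_eq)
qed

lemma G_left:
  assumes "i < n" "j < n"
  shows "(\<Sum>k<n. G X i k * of_real (h X k j)) = (if i = j then 1 else 0) + z * G X i j"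
proof -
  have "(\<Sum>k<n. G X i k * shift (h X) z k j) = (if i = j then 1 else 0)"
    using G_resolvent[of X] assms unfolding is_resolvent_def by blast
  then show ?thesis unfolding sum_shift(2)[OF assms(2)] by (simp only: diff_eq_eq mult.commute)
qed

text \<open>
  Flipping an edge changes \<open>H\<close> in two places only, so the resolvent identity has two terms.
\<close>

lemma G_flip:
  assumes ij: "i < n" "j < n" "i \<noteq> j" and ab: "a < n" "b < n"
  shows "G (X({i, j} := True)) a b - G (X({i, j} := False)) a b =
    of_real (1 / (2 * sqrt n)) *
      (G (X({i, j} := True)) a i * G (X({i, j} := False)) j b +
       G (X({i, j} := True)) a j * G (X({i, j} := False)) i b)"
proof -
  define X1 where "X1 = X({i, j} := True)"
  define X0 where "X0 = X({i, j} := False)"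
  define c where "c = complex_of_real (1 / (2 * sqrt n))"
  have diff: "complex_of_real (h X0 k l - h X1 k l) =
      (if k = i then (if l = j then c else 0) else 0) + (if k = j then (if l = i then c else 0) else 0)" for k l
    using ij(3)
    by (auto simp: X0_def X1_def c_def normalized_weights_def edge_weight_def doubleton_eq_iff field_simps)
  have "G X1 a b - G X0 a b = (\<Sum>k<n. \<Sum>l<n. G X1 a k * complex_of_real (h X0 k l - h X1 k l) * G X0 l b)"
    by (rule resolvent_identity[OF G_resolvent G_resolvent ab])
  also have "\<dots> = (\<Sum>k<n. \<Sum>l<n. (if k = i then (if l = j then G X1 a k * c * G X0 l b else 0) else 0) +
      (if k = j then (if l = i then G X1 a k * c * G X0 l b else 0) else 0))"
    unfolding diff by (intro sum.cong refl) (auto simp: algebra_simps)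
  also have "\<dots> = (\<Sum>k<n. (if k = i then G X1 a k * c * G X0 j b else 0) + (if k = j then G X1 a k * c * G X0 i b else 0))"
    using ij by (intro sum.cong refl) (auto simp: sum.distrib)
  also have "\<dots> = c * (G X1 a i * G X0 j b + G X1 a j * G X0 i b)"
    using ij by (simp add: sum.distrib algebra_simps)
  finally show ?thesis by (simp add: X1_def X0_def c_def)
qed

lemma norm_flip_bound:
  assumes "cmod u \<le> y" "cmod v \<le> y"
  shows "cmod (of_real (1 / (2 * sqrt n)) * (u + v)) \<le> y / sqrt n"
proof -
  have "cmod (u + v) \<le> 2 * y" using norm_triangle_le[of u v "2 * y"] assms by simp
  then have "(1 / (2 * sqrt n)) * cmod (u + v) \<le> (1 / (2 * sqrt n)) * (2 * y)"
    by (intro mult_left_mono) auto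
  then show ?thesis by (simp only: norm_mult norm_of_real) simp
qed

lemma G_flip_bound:
  assumes ij: "i < n" "j < n" "i \<noteq> j" and ab: "a < n" "b < n"
  shows "cmod (G (X({i, j} := True)) a b - G (X({i, j} := False)) a b) \<le> 1 / x\<^sup>2 / sqrt n"
  unfolding G_flip[OF ij ab]
proof (rule norm_flip_bound)
  have *: "cmod (G Y a' k * G Y' l b') \<le> 1 / x\<^sup>2" if "a' < n" "k < n" "l < n" "b' < n" for Y Y' k l a' b'
  proof -
    have "cmod (G Y a' k) * cmod (G Y' l b') \<le> (1 / x) * (1 / x)"
      using that x by (intro mult_mono G_entry) auto
    then show ?thesis by (simp add: norm_mult power2_eq_square)
  qed
  show "cmod (G (X({i, j} := True)) a i * G (X({i, j} := False)) j b) \<le> 1 / x\<^sup>2"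
    "cmod (G (X({i, j} := True)) a j * G (X({i, j} := False)) i b) \<le> 1 / x\<^sup>2"
    using * ij ab by auto
qed

lemma G_set_bound:
  assumes ij: "i < n" "j < n" "i \<noteq> j" and ab: "a < n" "b < n"
  shows "cmod (G (X({i, j} := c)) a b - G X a b) \<le> 1 / x\<^sup>2 / sqrt n"
proof -
  consider "c = X {i, j}" | "c = True" "X {i, j} = False" | "c = False" "X {i, j} = True" by auto
  then show ?thesis
  proof cases
    case 1
    then show ?thesis by simp
  next
    case 2
    then have "X({i, j} := False) = X" by (intro fun_upd_idem)
    with 2 G_flip_bound[OF ij ab, of X] show ?thesis by (simp del: divide_divide_eq_left)
  next
    case 3
    then have "X({i, j} := True) = X" by (intro fun_upd_idem)
    with 3 G_flip_bound[OF ij ab, of X] show ?thesis by (simp add: norm_minus_commute del: divide_divide_eq_left)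
  qed
qed

text \<open>
  The trace of a rank-two perturbation gains a factor \<open>n\<close> over the entrywise bound: the sum over the
  diagonal of \<open>G\<^sub>a\<^sub>i G'\<^sub>j\<^sub>a\<close> is an inner product of a column and a row, both of norm at most \<open>1/x\<close>.
\<close>

lemma s_flip_bound:
  assumes e: "e \<in> vertex_pairs n"
  shows "cmod (s (X(e := True)) - s (X(e := False))) \<le> 1 / (n * sqrt n * x\<^sup>2)"
proof -
  obtain i j where e: "e = {i, j}" and ij: "i \<noteq> j" "i < n" "j < n"
    using e by (auto simp: vertex_pairs_def card_2_iff)
  define X1 where "X1 = X({i, j} := True)"
  define X0 where "X0 = X({i, j} := False)"
  have L2: "L2_set (\<lambda>a. cmod (G Y a k)) {..<n} \<le> 1 / x" "L2_set (\<lambda>a. cmod (G Y k a)) {..<n} \<le> 1 / x"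
    if "k < n" for Y k
    using G_column[OF that, of Y] G_row[OF that, of Y] x
    by (auto simp: L2_set_def real_sqrt_divide intro!: real_le_lsqrt sum_nonneg simp: power_divide)
  have *: "cmod (\<Sum>a<n. G X1 a k * G X0 l a) \<le> 1 / x\<^sup>2" if "k < n" "l < n" for k l
  proof -
    have "cmod (\<Sum>a<n. G X1 a k * G X0 l a) \<le> L2_set (\<lambda>a. cmod (G X1 a k)) {..<n} * L2_set (\<lambda>a. cmod (G X0 l a)) {..<n}"
      by (rule norm_sum_mult_le_L2_set)
    also have "\<dots> \<le> (1 / x) * (1 / x)" using x by (intro mult_mono L2 that L2_set_nonneg) auto
    finally show ?thesis by (simp add: power2_eq_square)
  qed
  have "s X1 - s X0 = (\<Sum>a<n. G X1 a a - G X0 a a) / of_nat n"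
    by (simp add: s_eq sum_subtractf diff_divide_distrib)
  also have "(\<Sum>a<n. G X1 a a - G X0 a a) =
      of_real (1 / (2 * sqrt n)) * ((\<Sum>a<n. G X1 a i * G X0 j a) + (\<Sum>a<n. G X1 a j * G X0 i a))"
    using G_flip[OF ij(2,3,1)] by (simp add: X1_def X0_def sum_distrib_left sum.distrib distrib_left)
  finally have "cmod (s X1 - s X0) = cmod (of_real (1 / (2 * sqrt n)) *
      ((\<Sum>a<n. G X1 a i * G X0 j a) + (\<Sum>a<n. G X1 a j * G X0 i a))) / n"
    by (simp only: norm_divide norm_of_nat)
  also have "\<dots> \<le> (1 / x\<^sup>2 / sqrt n) / n"
    by (intro divide_right_mono norm_flip_bound * ij) simp
  finally have "cmod (s X1 - s X0) \<le> (1 / x\<^sup>2 / sqrt n) / n" .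
  then show ?thesis by (simp add: X1_def X0_def e mult_ac)
qed

lemma s_variance: "E (\<lambda>X. (cmod (s X - m))\<^sup>2) \<le> 1 / (n * x ^ 4)"
proof -
  have "E (\<lambda>X. (cmod (s X - m))\<^sup>2) \<le> real (card (vertex_pairs n)) * (1 / (n * sqrt n * x\<^sup>2))\<^sup>2"
    unfolding m_def by (rule coin_variance_bound[OF finite_vertex_pairs p]) (rule s_flip_bound)
  also have "\<dots> \<le> (real n)\<^sup>2 * (1 / (n * sqrt n * x\<^sup>2))\<^sup>2"
    by (intro mult_right_mono card_vertex_pairs_le) auto
  also have "\<dots> = 1 / (n * x ^ 4)"
    using n by (simp add: power_divide power_mult_distrib flip: power_mult)
  finally show ?thesis .
qed


definition \<sigma> where "\<sigma> = sqrt (p * (1 - p)) / 2"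

lemma \<sigma>: "\<sigma> > 0" "\<sigma>\<^sup>2 = p * (1 - p) / 4" "\<sigma>\<^sup>2 \<le> 1 / 4"
proof -
  show "\<sigma> > 0" using p01 by (simp add: \<sigma>_def)
  show *: "\<sigma>\<^sup>2 = p * (1 - p) / 4" using p01 by (simp add: \<sigma>_def power_divide)
  show "\<sigma>\<^sup>2 \<le> 1 / 4" unfolding * using p mult_le_one[of p "1 - p"] by simp
qed

lemma integrable_E [simp, intro]:
  fixes f :: "(nat set \<Rightarrow> bool) \<Rightarrow> 'b :: {banach, second_countable_topology}"
  shows "integrable (measure_pmf (coin_pmf (vertex_pairs n) p)) f"
  by (rule integrable_coin_pmf) simp

lemma norm_E_le: "(\<And>X. cmod (f X) \<le> c) \<Longrightarrow> cmod (E f) \<le> c"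
  by (rule norm_expectation_coin_le) simp

lemma weight_mean: "t * (1 / 2 / r) + (1 - t) * (1 / r) = (1 - t / 2) / r" for t r :: real
proof -
  have "t * (1 / 2 / r) + (1 - t) * (1 / r) = (t * (1 / 2) + (1 - t)) / r"
    unfolding add_divide_distrib by simp
  then show ?thesis by simp
qed

lemma weight_gap:
  fixes t r N :: real
  assumes r: "r > 0" "r * r = N"
  shows "t * (1 - t) * (1 / 2 / r - 1 / r) * (1 / (2 * r)) = - (t * (1 - t) / 4 / N)"
proof -
  have "1 / 2 / r - 1 / r = - (1 / (2 * r))" using r by (simp add: field_simps)
  then have "t * (1 - t) * (1 / 2 / r - 1 / r) * (1 / (2 * r)) = - (t * (1 - t)) * ((1 / (2 * r)) * (1 / (2 * r)))"
    by simp
  also have "(1 / (2 * r)) * (1 / (2 * r)) = 1 / (4 * N)" unfolding r(2)[symmetric] by simp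
  finally show ?thesis by simp
qed

text \<open>
  Integration by parts in the single entry \<open>h\<^sub>i\<^sub>k\<close>. The step between its two values is
  \<open>- 1 / (2 sqrt n)\<close> and the flip formula contributes the same factor with the opposite sign, whence
  the coefficient \<open>\<sigma>\<^sup>2 / n\<close> with \<open>\<sigma>\<^sup>2 = p (1 - p) / 4\<close>.
\<close>

lemma expectation_weight_resolvent:
  assumes ik: "i < n" "k < n" "i \<noteq> k"
  shows "E (\<lambda>X. of_real (h X i k) * G X k i) =
    of_real ((1 - p / 2) / sqrt n) * E (\<lambda>X. G X k i) -
    of_real (\<sigma>\<^sup>2 / n) * E (\<lambda>X.
      G (X({i, k} := True)) k i * G (X({i, k} := False)) k i +
      G (X({i, k} := True)) k k * G (X({i, k} := False)) i i)"
proof -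
  have e: "{i, k} \<in> vertex_pairs n" using ik by (simp add: pair_mem_vertex_pairs)
  define w where "w b = edge_weight b / sqrt n" for b
  have w1: "p * w True + (1 - p) * w False = (1 - p / 2) / sqrt n"
    unfolding w_def edge_weight_def if_True if_False by (rule weight_mean)
  have w2: "p * (1 - p) * (w True - w False) * (1 / (2 * sqrt n)) = - (\<sigma>\<^sup>2 / n)"
    unfolding w_def edge_weight_def if_True if_False \<sigma>(2) by (rule weight_gap) (use n in auto)
  have "E (\<lambda>X. of_real (h X i k) * G X k i) = E (\<lambda>X. of_real (w (X {i, k})) * G X k i)"
    using ik by (simp add: normalized_weights_def w_def)
  also have "\<dots> = of_real (p * w True + (1 - p) * w False) * E (\<lambda>X. G X k i) +
      of_real (p * (1 - p) * (w True - w False)) * E (\<lambda>X. G (X({i, k} := True)) k i - G (X({i, k} := False)) k i)"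
    by (rule coin_integration_by_parts[OF finite_vertex_pairs e p])
  also have "E (\<lambda>X. G (X({i, k} := True)) k i - G (X({i, k} := False)) k i) =
      of_real (1 / (2 * sqrt n)) * E (\<lambda>X.
      G (X({i, k} := True)) k i * G (X({i, k} := False)) k i +
      G (X({i, k} := True)) k k * G (X({i, k} := False)) i i)"
    unfolding G_flip[OF ik ik(2,1)] by (rule integral_mult_right_zero)
  finally show ?thesis
    unfolding w1 mult.assoc[symmetric] of_real_mult[symmetric] w2 by (simp only: of_real_minus) simp
qed

text \<open>
  The right-hand side of \<open>expectation_weight_resolvent\<close> with the flipped resolvents replaced by \<open>G\<close>.
  It is also meaningful on the diagonal, so that its sum over all pairs is expressed by the trace and
  by the sum of the entries of \<open>G\<close>.
\<close>

definition loop_term where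
  "loop_term i k = of_real ((1 - p / 2) / sqrt n) * E (\<lambda>X. G X k i) -
    of_real (\<sigma>\<^sup>2 / n) * E (\<lambda>X. G X k i * G X k i + G X k k * G X i i)"

lemma product_arith: "(1 / y\<^sup>2 / r) * (1 / y) + (1 / y) * (1 / y\<^sup>2 / r) = 2 / (y ^ 3 * r)" for y r :: real
  by (simp add: power2_eq_square power3_eq_cube)

lemma diagonal_arith:
  "(1 / 4 / N) * ((1 / y) * (1 / y) + (1 / y) * (1 / y)) + (1 / r) * (1 / y) = 1 / r * (1 / y) + 1 / N * (1 / (2 * y\<^sup>2))"
  for y r N :: real
  by (simp add: power2_eq_square)

lemma G_product_perturbation:
  assumes ij: "i < n" "j < n" "i \<noteq> j" and "a < n" "b < n" "k < n" "l < n"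
  shows "cmod (G (X({i, j} := c)) a b * G (X({i, j} := d)) k l - G X a b * G X k l) \<le> 2 / (x ^ 3 * sqrt n)"
proof -
  let ?c = "X({i, j} := c)" and ?d = "X({i, j} := d)"
  have "G ?c a b * G ?d k l - G X a b * G X k l =
    (G ?c a b - G X a b) * G ?d k l + G X a b * (G ?d k l - G X k l)"
    by (simp add: algebra_simps)
  also have "cmod \<dots> \<le> (1 / x\<^sup>2 / sqrt n) * (1 / x) + (1 / x) * (1 / x\<^sup>2 / sqrt n)"
    by (rule norm_triangle_le, unfold norm_mult)
       (intro add_mono mult_mono G_set_bound G_entry assms norm_ge_zero divide_nonneg_nonneg; use x in simp)
  also have "\<dots> = 2 / (x ^ 3 * sqrt n)"
    by (rule product_arith)
  finally show ?thesis .
qed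

lemma quarter: "(1 / 4) / a * (4 / b) = 1 / a * (1 / b)" for a b :: real
  by simp

lemma two_twos: "2 / b + 2 / b = 4 / b" for b :: real
  by simp

lemma diff_common: "(u - c * a) - (u - c * b) = - (c * (a - b))" for a b c u :: complex
  by (simp add: algebra_simps)

lemma loop_term_off_diagonal:
  assumes ik: "i < n" "k < n" "i \<noteq> k"
  shows "cmod (E (\<lambda>X. of_real (h X i k) * G X k i) - loop_term i k) \<le> 1 / n * (1 / (x ^ 3 * sqrt n))"
proof -
  let ?A = "\<lambda>X. G (X({i, k} := True)) k i * G (X({i, k} := False)) k i +
      G (X({i, k} := True)) k k * G (X({i, k} := False)) i i"
  let ?B = "\<lambda>X. G X k i * G X k i + G X k k * G X i i"
  have AB: "cmod (E (\<lambda>X. ?A X - ?B X)) \<le> 2 / (x ^ 3 * sqrt n) + 2 / (x ^ 3 * sqrt n)"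
  proof (rule norm_E_le)
    fix X
    have "?A X - ?B X = (G (X({i, k} := True)) k i * G (X({i, k} := False)) k i - G X k i * G X k i) +
        (G (X({i, k} := True)) k k * G (X({i, k} := False)) i i - G X k k * G X i i)"
      by simp
    also have "cmod \<dots> \<le> 2 / (x ^ 3 * sqrt n) + 2 / (x ^ 3 * sqrt n)"
      by (intro norm_triangle_le add_mono G_product_perturbation ik)
    finally show "cmod (?A X - ?B X) \<le> 2 / (x ^ 3 * sqrt n) + 2 / (x ^ 3 * sqrt n)" .
  qed
  have "E (\<lambda>X. of_real (h X i k) * G X k i) - loop_term i k = - (of_real (\<sigma>\<^sup>2 / n) * (E ?A - E ?B))"
    unfolding expectation_weight_resolvent[OF ik] loop_term_def
    by (rule diff_common)
  also have "E ?A - E ?B = E (\<lambda>X. ?A X - ?B X)"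
    by (rule Bochner_Integration.integral_diff[symmetric]) auto
  finally have "cmod (E (\<lambda>X. of_real (h X i k) * G X k i) - loop_term i k) =
      \<sigma>\<^sup>2 / n * cmod (E (\<lambda>X. ?A X - ?B X))"
    by (simp only: norm_minus_cancel norm_mult norm_of_real) simp
  also have "\<dots> \<le> (1 / 4) / n * (4 / (x ^ 3 * sqrt n))"
    by (intro mult_mono divide_right_mono \<sigma> AB[unfolded two_twos]) (use x in simp_all)
  also have "\<dots> = 1 / n * (1 / (x ^ 3 * sqrt n))" by (rule quarter)
  finally show ?thesis .
qed

lemma loop_term_diagonal:
  assumes i: "i < n"
  shows "cmod (E (\<lambda>X. of_real (h X i i) * G X i i) - loop_term i i) \<le> 1 / sqrt n * (1 / x) + 1 / n * (1 / (2 * x\<^sup>2))"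
proof -
  have B: "cmod (G X i i * G X i i + G X i i * G X i i) \<le> (1 / x) * (1 / x) + (1 / x) * (1 / x)" for X
    by (rule norm_triangle_le, unfold norm_mult)
       (intro add_mono mult_mono G_entry i norm_ge_zero; use x in simp)
  have "E (\<lambda>X. of_real (h X i i) * G X i i) - loop_term i i =
      of_real (\<sigma>\<^sup>2 / n) * E (\<lambda>X. G X i i * G X i i + G X i i * G X i i) -
      of_real ((1 - p / 2) / sqrt n) * E (\<lambda>X. G X i i)"
    by (simp add: loop_term_def normalized_weights_def)
  also have "cmod \<dots> \<le> (1 / 4 / n) * ((1 / x) * (1 / x) + (1 / x) * (1 / x)) + (1 / sqrt n) * (1 / x)"
  proof (rule order_trans[OF norm_triangle_ineq4], unfold norm_mult norm_of_real, intro add_mono mult_mono)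
    show "\<bar>\<sigma>\<^sup>2 / n\<bar> \<le> 1 / 4 / n" using divide_right_mono[OF \<sigma>(3), of n] by simp
    show "\<bar>(1 - p / 2) / sqrt n\<bar> \<le> 1 / sqrt n" using p by (simp add: divide_right_mono)
    show "cmod (E (\<lambda>X. G X i i * G X i i + G X i i * G X i i)) \<le> (1 / x) * (1 / x) + (1 / x) * (1 / x)"
      by (rule norm_E_le[OF B])
    show "cmod (E (\<lambda>X. G X i i)) \<le> 1 / x" by (rule norm_E_le[OF G_entry[OF i i]])
  qed (use x in auto)
  also have "\<dots> = 1 / sqrt n * (1 / x) + 1 / n * (1 / (2 * x\<^sup>2))"
    by (rule diagonal_arith)
  finally show ?thesis .
qed

lemma loop_error_arith:
  fixes N r y :: real
  assumes "N > 0" "r > 0" "y > 0"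
  shows "N * (1 / r * (1 / y) + 1 / N * (1 / (2 * y\<^sup>2))) + N * (N * (1 / N * (1 / (y ^ 3 * r)))) +
      1 / r * (N / y) + (1 / 4 / N) * (N * (1 / y\<^sup>2)) =
    N * ((2 / y) / r + (3 / (4 * y\<^sup>2)) / N + (1 / y ^ 3) / r)"
proof -
  define a b c where "a = 1 / y" and "b = 1 / r" and "c = 1 / N"
  have e: "1 / (2 * y\<^sup>2) = a\<^sup>2 / 2" "1 / (y ^ 3 * r) = a ^ 3 * b" "1 / y\<^sup>2 = a\<^sup>2" "1 / 4 / N = c / 4"
    "N / y = N * a" "2 / y / r = 2 * (a * b)" "3 / (4 * y\<^sup>2) / N = c * (3 / 4 * a\<^sup>2)" "1 / y ^ 3 / r = a ^ 3 * b"
    by (simp_all add: a_def b_def c_def power_divide)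
  have N: "N * (c * u) = u" "c / 4 * (N * u) = u / 4" for u using assms(1) by (simp_all add: c_def)
  show ?thesis
    unfolding e a_def[symmetric] b_def[symmetric] c_def[symmetric] distrib_left N by simp
qed

lemma loop_error_arith2:
  fixes w a b c d r :: real
  assumes "w \<le> a / r + b + c / r" "b \<le> d / r"
  shows "w \<le> (a + d + c) / r"
  using assms by (simp add: add_divide_distrib)

text \<open>
  Summing the loop terms produces \<open>\<sigma>\<^sup>2 E s\<^sup>2\<close> and two small contributions: the sum of all entries of
  \<open>G\<close>, a quadratic form at the all-ones vector, and the sum of their squares, at most \<open>n / x\<^sup>2\<close> in modulus.
\<close>

lemma loop_equation:
  "cmod (1 + z * m + of_real (\<sigma>\<^sup>2) * E (\<lambda>X. s X * s X)) \<le> (2 / x + 1 / x\<^sup>2 + 1 / x ^ 3) / sqrt n"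
proof -
  define D where "D i k = E (\<lambda>X. of_real (h X i k) * G X k i) - loop_term i k" for i k
  have N: "complex_of_nat n \<noteq> 0" using n by simp
  have hG: "(\<Sum>i<n. \<Sum>k<n. E (\<lambda>X. of_real (h X i k) * G X k i)) = of_nat n * (1 + z * m)"
  proof -
    have "(\<Sum>i<n. \<Sum>k<n. E (\<lambda>X. of_real (h X i k) * G X k i)) =
        E (\<lambda>X. \<Sum>i<n. \<Sum>k<n. of_real (h X i k) * G X k i)"
      by (simp add: Bochner_Integration.integral_sum)
    also have "\<dots> = E (\<lambda>X. of_nat n * (1 + z * s X))"
      using N by (intro Bochner_Integration.integral_cong refl)
        (simp add: G_right sum.distrib sum_distrib_left[symmetric] s_eq distrib_left)
    also have "\<dots> = of_nat n * (1 + z * m)"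
      by (simp add: m_def)
    finally show ?thesis .
  qed
  have loop: "(\<Sum>i<n. \<Sum>k<n. loop_term i k) =
      of_real ((1 - p / 2) / sqrt n) * E (\<lambda>X. \<Sum>i<n. \<Sum>k<n. G X k i) -
      of_real (\<sigma>\<^sup>2 / n) * E (\<lambda>X. \<Sum>i<n. \<Sum>k<n. G X k i * G X k i) -
      of_nat n * (of_real (\<sigma>\<^sup>2) * E (\<lambda>X. s X * s X))"
  proof -
    have "(\<Sum>i<n. \<Sum>k<n. E (\<lambda>X. G X k k * G X i i)) = E (\<lambda>X. \<Sum>i<n. \<Sum>k<n. G X k k * G X i i)"
      by (simp add: Bochner_Integration.integral_sum)
    also have "\<dots> = E (\<lambda>X. of_nat n * (of_nat n * (s X * s X)))"
      using N by (intro Bochner_Integration.integral_cong refl)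
        (simp add: s_eq sum_distrib_left[symmetric] sum_distrib_right[symmetric])
    finally have 1: "(\<Sum>i<n. \<Sum>k<n. E (\<lambda>X. G X k k * G X i i)) = of_nat n * (of_nat n * E (\<lambda>X. s X * s X))"
      by simp
    have "(\<Sum>i<n. \<Sum>k<n. loop_term i k) =
      of_real ((1 - p / 2) / sqrt n) * (\<Sum>i<n. \<Sum>k<n. E (\<lambda>X. G X k i)) -
      of_real (\<sigma>\<^sup>2 / n) * ((\<Sum>i<n. \<Sum>k<n. E (\<lambda>X. G X k i * G X k i)) + (\<Sum>i<n. \<Sum>k<n. E (\<lambda>X. G X k k * G X i i)))"
      unfolding loop_term_def Bochner_Integration.integral_add[OF integrable_E integrable_E]
      by (simp only: sum_subtractf sum_distrib_left[symmetric] sum.distrib)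
    also have "of_real (\<sigma>\<^sup>2 / n) * ((\<Sum>i<n. \<Sum>k<n. E (\<lambda>X. G X k i * G X k i)) + (\<Sum>i<n. \<Sum>k<n. E (\<lambda>X. G X k k * G X i i))) =
      of_real (\<sigma>\<^sup>2 / n) * (\<Sum>i<n. \<Sum>k<n. E (\<lambda>X. G X k i * G X k i)) + of_nat n * (of_real (\<sigma>\<^sup>2) * E (\<lambda>X. s X * s X))"
      unfolding 1 using N by (simp add: distrib_left)
    finally show ?thesis by (simp add: Bochner_Integration.integral_sum)
  qed
  let ?W = "1 + z * m + of_real (\<sigma>\<^sup>2) * E (\<lambda>X. s X * s X)"
  let ?S = "(\<Sum>i<n. \<Sum>k<n. D i k) +
      of_real ((1 - p / 2) / sqrt n) * E (\<lambda>X. \<Sum>i<n. \<Sum>k<n. G X k i) -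
      of_real (\<sigma>\<^sup>2 / n) * E (\<lambda>X. \<Sum>i<n. \<Sum>k<n. G X k i * G X k i)"
  have S: "of_nat n * ?W = ?S"
    unfolding D_def sum_subtractf hG loop by (simp only: algebra_simps)
  have "n * cmod ?W = cmod ?S"
    unfolding S[symmetric] by (simp only: norm_mult norm_of_nat)
  also have "\<dots> \<le> (n * (1 / sqrt n * (1 / x) + 1 / n * (1 / (2 * x\<^sup>2))) + n * (n * (1 / n * (1 / (x ^ 3 * sqrt n))))) +
      1 / sqrt n * (n / x) + (1 / 4 / n) * (n * (1 / x\<^sup>2))"
  proof (rule order_trans[OF norm_triangle_ineq4], rule add_mono, rule norm_triangle_le, rule add_mono)
    have "cmod (\<Sum>i<n. \<Sum>k<n. D i k) \<le> (\<Sum>i<n. \<Sum>k<n. (if k = i then 1 / sqrt n * (1 / x) + 1 / n * (1 / (2 * x\<^sup>2)) else 0) +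
        1 / n * (1 / (x ^ 3 * sqrt n)))"
    proof (intro sum_norm_le)
      fix i k assume "i \<in> {..<n}" "k \<in> {..<n}"
      then show "cmod (D i k) \<le> (if k = i then 1 / sqrt n * (1 / x) + 1 / n * (1 / (2 * x\<^sup>2)) else 0) + 1 / n * (1 / (x ^ 3 * sqrt n))"
        using loop_term_diagonal[of i] loop_term_off_diagonal[of i k] x
        by (cases "i = k") (auto simp: D_def intro: add_increasing2)
    qed
    also have "\<dots> = n * (1 / sqrt n * (1 / x) + 1 / n * (1 / (2 * x\<^sup>2))) + n * (n * (1 / n * (1 / (x ^ 3 * sqrt n))))"
      unfolding sum.distrib by (simp del: mult_divide_mult_cancel_left_if add: sum.delta)
    finally show "cmod (\<Sum>i<n. \<Sum>k<n. D i k) \<le> \<dots>" .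
    show "cmod (of_real ((1 - p / 2) / sqrt n) * E (\<lambda>X. \<Sum>i<n. \<Sum>k<n. G X k i)) \<le> 1 / sqrt n * (n / x)"
      unfolding norm_mult norm_of_real
    proof (rule mult_mono)
      show "\<bar>(1 - p / 2) / sqrt n\<bar> \<le> 1 / sqrt n" using p by (simp add: divide_right_mono)
      show "cmod (E (\<lambda>X. \<Sum>i<n. \<Sum>k<n. G X k i)) \<le> n / x"
        by (rule norm_E_le, subst sum.swap) (use G_quadratic_form[of "\<lambda>_. 1"] in simp)
    qed auto
    show "cmod (of_real (\<sigma>\<^sup>2 / n) * E (\<lambda>X. \<Sum>i<n. \<Sum>k<n. G X k i * G X k i)) \<le> (1 / 4 / n) * (n * (1 / x\<^sup>2))"
      unfolding norm_mult norm_of_real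
    proof (rule mult_mono)
      show "\<bar>\<sigma>\<^sup>2 / n\<bar> \<le> 1 / 4 / n" using divide_right_mono[OF \<sigma>(3), of n] by simp
      show "cmod (E (\<lambda>X. \<Sum>i<n. \<Sum>k<n. G X k i * G X k i)) \<le> n * (1 / x\<^sup>2)"
      proof (rule norm_E_le)
        fix X
        have "cmod (\<Sum>i<n. \<Sum>k<n. G X k i * G X k i) \<le> (\<Sum>i<n. 1 / x\<^sup>2)"
        proof (rule sum_norm_le)
          fix i assume "i \<in> {..<n}"
          then show "cmod (\<Sum>k<n. G X k i * G X k i) \<le> 1 / x\<^sup>2"
            using norm_sum[of "\<lambda>k. G X k i * G X k i" "{..<n}"] G_column[of i X]
            by (simp add: norm_mult power2_eq_square)
        qed
        then show "cmod (\<Sum>i<n. \<Sum>k<n. G X k i * G X k i) \<le> n * (1 / x\<^sup>2)" by simp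
      qed
    qed auto
  qed
  also have "\<dots> = n * ((2 / x) / sqrt n + (3 / (4 * x\<^sup>2)) / n + (1 / x ^ 3) / sqrt n)"
    by (rule loop_error_arith) (use n x in auto)
  finally have "n * cmod ?W \<le> n * ((2 / x) / sqrt n + (3 / (4 * x\<^sup>2)) / n + (1 / x ^ 3) / sqrt n)" .
  moreover have "real n > 0" using n by simp
  ultimately have 1: "cmod ?W \<le> (2 / x) / sqrt n + (3 / (4 * x\<^sup>2)) / n + (1 / x ^ 3) / sqrt n"
    by (rule mult_left_le_imp_le)
  have 2: "(3 / (4 * x\<^sup>2)) / n \<le> (1 / x\<^sup>2) / sqrt n"
  proof (rule frac_le)
    show "sqrt n \<le> n" using n by (intro real_le_lsqrt) (auto simp: power2_eq_square)
    show "3 / (4 * x\<^sup>2) \<le> 1 / x\<^sup>2" using x by (simp add: divide_simps)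
  qed (use n in auto)
  show ?thesis by (rule loop_error_arith2[OF 1 2])
qed

lemma mean_square_minus_square_mean: "cmod (E (\<lambda>X. s X * s X) - m * m) \<le> 1 / (n * x ^ 4)"
proof -
  have "E (\<lambda>X. (s X - m) * (s X - m)) = E (\<lambda>X. s X * s X - (2 * m * s X - m * m))"
    by (intro Bochner_Integration.integral_cong refl) (simp add: algebra_simps)
  also have "\<dots> = E (\<lambda>X. s X * s X) - (E (\<lambda>X. 2 * m * s X) - E (\<lambda>X. m * m))"
    by (simp only: Bochner_Integration.integral_diff[OF integrable_E integrable_E])
  also have "E (\<lambda>X. 2 * m * s X) = 2 * m * m"
    by (simp only: integral_mult_right_zero m_def[symmetric])
  finally have "E (\<lambda>X. s X * s X) - m * m = E (\<lambda>X. (s X - m) * (s X - m))"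
    by simp
  then have "cmod (E (\<lambda>X. s X * s X) - m * m) \<le> E (\<lambda>X. cmod ((s X - m) * (s X - m)))"
    by (simp only: integral_norm_bound)
  also have "\<dots> = E (\<lambda>X. (cmod (s X - m))\<^sup>2)"
    by (simp only: norm_mult power2_eq_square)
  also note s_variance
  finally show ?thesis .
qed

lemma mean_quadratic_equation:
  "cmod (1 + z * m + of_real (\<sigma>\<^sup>2) * (m * m)) \<le> (2 / x + 1 / x\<^sup>2 + 1 / x ^ 3 + 1 / x ^ 4) / sqrt n"
proof -
  let ?S = "E (\<lambda>X. s X * s X)"
  have "cmod (of_real (\<sigma>\<^sup>2) * (?S - m * m)) \<le> 1 * (1 / (n * x ^ 4))"
    unfolding norm_mult norm_of_real
    by (intro mult_mono mean_square_minus_square_mean) (use \<sigma>(3) in auto)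
  also have "\<dots> \<le> (1 / x ^ 4) / sqrt n"
  proof -
    have "sqrt n \<le> n" using n by (intro real_le_lsqrt) (auto simp: power2_eq_square)
    then have "(1 / x ^ 4) / n \<le> (1 / x ^ 4) / sqrt n" using n x by (intro frac_le) auto
    then show ?thesis by (simp only: divide_divide_eq_left mult_1 mult.commute)
  qed
  finally have 1: "cmod (of_real (\<sigma>\<^sup>2) * (?S - m * m)) \<le> (1 / x ^ 4) / sqrt n" .
  have eq: "1 + z * m + of_real (\<sigma>\<^sup>2) * (m * m) = (1 + z * m + of_real (\<sigma>\<^sup>2) * ?S) - of_real (\<sigma>\<^sup>2) * (?S - m * m)"
    unfolding right_diff_distrib by simp
  have "cmod (1 + z * m + of_real (\<sigma>\<^sup>2) * (m * m)) \<le>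
      (2 / x + 1 / x\<^sup>2 + 1 / x ^ 3) / sqrt n + (1 / x ^ 4) / sqrt n"
    unfolding eq by (rule order_trans[OF norm_triangle_ineq4 add_mono[OF loop_equation 1]])
  then show ?thesis unfolding add_divide_distrib .
qed

text \<open>
  Each eigenvalue contributes \<open>x / (e\<^sup>2 + x\<^sup>2)\<close>.
\<close>

lemma Im_s_nonneg: "Im (s X) \<ge> 0"
proof -
  obtain es where es: "\<And>z. Im z > 0 \<Longrightarrow> stieltjes n (h X) z = (\<Sum>e\<leftarrow>es. 1 / (complex_of_real e - z)) / of_nat n"
    using stieltjes_eq_eigenvalue_sum[OF symmetric_normalized_weights] by metis
  have "Im (\<Sum>e\<leftarrow>es. 1 / (complex_of_real e - z)) \<ge> 0"
    using x by (induction es) (auto simp: Im_divide z intro!: add_nonneg_nonneg)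
  then show ?thesis by (simp add: s_def es z x)
qed

lemma Im_m_nonneg: "Im m \<ge> 0"
  unfolding m_def integral_Im[OF integrable_E, symmetric] by (rule Bochner_Integration.integral_nonneg) (simp add: Im_s_nonneg)

definition m0 where "m0 = Complex 0 (semicircle_im \<sigma> x)"

text \<open>
  The quadratic equation has two roots near which \<open>m\<close> could lie; the sign of the imaginary part rules
  out the wrong one by keeping the cofactor of \<open>m - m0\<close> away from zero.
\<close>

lemma m_close: "cmod (m - m0) \<le> (2 / x + 1 / x\<^sup>2 + 1 / x ^ 3 + 1 / x ^ 4) / sqrt n / x"
proof -
  have "1 + z * m0 + of_real (\<sigma>\<^sup>2) * (m0 * m0) = 0"
    using semicircle_im_eq[OF \<sigma>(1), of x]
    by (simp add: complex_eq_iff m0_def z power2_eq_square algebra_simps)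
  moreover have "(m - m0) * (of_real (\<sigma>\<^sup>2) * (m + m0) + z) =
      (1 + z * m + of_real (\<sigma>\<^sup>2) * (m * m)) - (1 + z * m0 + of_real (\<sigma>\<^sup>2) * (m0 * m0))"
    by (simp add: algebra_simps)
  ultimately have eq: "(m - m0) * (of_real (\<sigma>\<^sup>2) * (m + m0) + z) = 1 + z * m + of_real (\<sigma>\<^sup>2) * (m * m)"
    by simp
  have "x \<le> Im (of_real (\<sigma>\<^sup>2) * (m + m0) + z)"
    using Im_m_nonneg semicircle_im_pos[OF \<sigma>(1), of x] by (simp add: z m0_def)
  also have "\<dots> \<le> cmod (of_real (\<sigma>\<^sup>2) * (m + m0) + z)"
    using abs_Im_le_cmod[of "of_real (\<sigma>\<^sup>2) * (m + m0) + z"] by linarith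
  finally have "cmod (m - m0) * x \<le> cmod (m - m0) * cmod (of_real (\<sigma>\<^sup>2) * (m + m0) + z)"
    by (rule mult_left_mono) simp
  also have "\<dots> = cmod (1 + z * m + of_real (\<sigma>\<^sup>2) * (m * m))"
    unfolding norm_mult[symmetric] eq ..
  also note mean_quadratic_equation
  finally show ?thesis using x by (simp only: pos_le_divide_eq)
qed

lemma expected_stieltjes_error:
  "E (\<lambda>X. cmod (s X - m0)) \<le> ((1 / x ^ 4 + 1) / 2 + (2 / x + 1 / x\<^sup>2 + 1 / x ^ 3 + 1 / x ^ 4) / x) / sqrt n"
proof -
  let ?r = "(2 / x + 1 / x\<^sup>2 + 1 / x ^ 3 + 1 / x ^ 4) / sqrt n / x"
  have rt: "sqrt n > 0" using n by simp
  have bound: "cmod (s X - m0) \<le> (sqrt n / 2) * (cmod (s X - m))\<^sup>2 + (1 / (2 * sqrt n) + ?r)" for X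
  proof -
    \<comment> \<open>This trades the first moment for the variance; \<open>t = sqrt n\<close> balances the two terms.\<close>
    have amgm: "y \<le> (t / 2) * y\<^sup>2 + 1 / (2 * t)" if "t > 0" for y t :: real
    proof -
      have "0 \<le> (t * y - 1)\<^sup>2 / (2 * t)" using that by simp
      also have "\<dots> = (t / 2) * y\<^sup>2 + 1 / (2 * t) - y"
        using that by (simp add: field_simps power2_eq_square)
      finally show ?thesis by simp
    qed
    have "cmod (s X - m0) \<le> cmod (s X - m) + cmod (m - m0)"
      using norm_triangle_ineq[of "s X - m" "m - m0"] by simp
    then show ?thesis using amgm[OF rt, of "cmod (s X - m)"] m_close by linarith
  qed
  have "E (\<lambda>X. cmod (s X - m0)) \<le> E (\<lambda>X. (sqrt n / 2) * (cmod (s X - m))\<^sup>2 + (1 / (2 * sqrt n) + ?r))"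
    by (rule expectation_coin_mono[OF finite_vertex_pairs bound])
  also have "\<dots> = E (\<lambda>X. (sqrt n / 2) * (cmod (s X - m))\<^sup>2) + E (\<lambda>X. 1 / (2 * sqrt n) + ?r)"
    by (rule Bochner_Integration.integral_add[OF integrable_E integrable_E])
  also have "E (\<lambda>X. (sqrt n / 2) * (cmod (s X - m))\<^sup>2) = (sqrt n / 2) * E (\<lambda>X. (cmod (s X - m))\<^sup>2)"
    by (rule integral_mult_right_zero)
  also have "E (\<lambda>X. 1 / (2 * sqrt n) + ?r) = 1 / (2 * sqrt n) + ?r"
    by (simp del: divide_divide_eq_left)
  also have "(sqrt n / 2) * E (\<lambda>X. (cmod (s X - m))\<^sup>2) \<le> (sqrt n / 2) * (1 / (n * x ^ 4))"
    by (rule mult_left_mono[OF s_variance]) simp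
  also have "(sqrt n / 2) * (1 / (n * x ^ 4)) + (1 / (2 * sqrt n) + ?r) =
      ((1 / x ^ 4 + 1) / 2 + (2 / x + 1 / x\<^sup>2 + 1 / x ^ 3 + 1 / x ^ 4) / x) / sqrt n"
  proof -
    have "(r / 2) * (1 / (N * a)) + (1 / (2 * r) + b / r / c) = ((1 / a + 1) / 2 + b / c) / r"
      if "r > 0" "r * r = N" for r N a b c :: real
    proof -
      have "(r / 2) * (1 / (N * a)) = (1 / a / 2) / r" unfolding that(2)[symmetric] using that(1) by simp
      then show ?thesis by (simp add: add_divide_distrib)
    qed
    from this[OF rt, of n] show ?thesis by simp
  qed
  finally show ?thesis by simp
qed

text \<open>
  Multiplying \<open>tr (H G)\<close> by \<open>z\<close> turns it into \<open>tr (H G H)\<close>, because \<open>H\<close> has zero diagonal. That trace is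
  a sum of \<open>n\<close> quadratic forms at the rows of \<open>H\<close>, which have norm at most 1. The decay \<open>1 / x\<^sup>2\<close> is what
  makes the Coulson integrals converge uniformly.
\<close>

lemma one_plus_z_s_bound: "cmod (1 + z * s X) \<le> 1 / x\<^sup>2"
proof -
  have N: "complex_of_nat n \<noteq> 0" using n by simp
  have tr: "of_nat n * (1 + z * s X) = (\<Sum>i<n. \<Sum>k<n. of_real (h X i k) * G X k i)"
    using N by (simp add: G_right sum.distrib sum_distrib_left[symmetric] s_eq distrib_left)
  have zi: "z * (\<Sum>k<n. of_real (h X i k) * G X k i) = (\<Sum>k<n. \<Sum>l<n. of_real (h X i k) * G X k l * of_real (h X i l))"
    if i: "i < n" for i
  proof -
    have "z * (\<Sum>k<n. of_real (h X i k) * G X k i) = (\<Sum>k<n. of_real (h X i k) * (\<Sum>l<n. G X k l * of_real (h X l i)))"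
    proof (subst sum_distrib_left, intro sum.cong refl)
      fix k assume "k \<in> {..<n}"
      then have "(\<Sum>l<n. G X k l * of_real (h X l i)) = (if k = i then 1 else 0) + z * G X k i"
        using i by (simp add: G_left)
      moreover have "of_real (h X i k) * (if k = i then 1 else 0) = (0 :: complex)"
        by (simp add: normalized_weights_def)
      ultimately show "z * (of_real (h X i k) * G X k i) = of_real (h X i k) * (\<Sum>l<n. G X k l * of_real (h X l i))"
        by (simp add: distrib_left)
    qed
    also have "\<dots> = (\<Sum>k<n. \<Sum>l<n. of_real (h X i k) * G X k l * of_real (h X i l))"
      unfolding sum_distrib_left
      by (intro sum.cong refl) (simp add: normalized_weights_def insert_commute mult.assoc)
    finally show ?thesis .
  qed
  have "z * (of_nat n * (1 + z * s X)) = (\<Sum>i<n. \<Sum>k<n. \<Sum>l<n. of_real (h X i k) * G X k l * of_real (h X i l))"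
    unfolding tr by (subst sum_distrib_left, rule sum.cong[OF refl], rule zi) simp
  then have "x * (n * cmod (1 + z * s X)) = cmod (\<Sum>i<n. \<Sum>k<n. \<Sum>l<n. of_real (h X i k) * G X k l * of_real (h X i l))"
    by (metis norm_mult norm_of_nat z(4))
  also have "\<dots> \<le> (\<Sum>i<n. 1 / x)"
  proof (rule sum_norm_le)
    fix i
    have "(\<Sum>k<n. (h X i k)\<^sup>2) \<le> (\<Sum>k<n. 1 / n)" by (intro sum_mono normalized_weights_sq_le)
    also have "\<dots> = 1" using n by simp
    finally have "(\<Sum>k<n. (h X i k)\<^sup>2) / x \<le> 1 / x" using x by (simp add: divide_right_mono)
    then show "cmod (\<Sum>k<n. \<Sum>l<n. of_real (h X i k) * G X k l * of_real (h X i l)) \<le> 1 / x"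
      using G_quadratic_form[of "h X i" X] by (rule order_trans[rotated])
  qed
  also have "\<dots> = n * (1 / x)" by simp
  finally have "n * (x * cmod (1 + z * s X)) \<le> n * (1 / x)" by (simp only: mult.left_commute)
  moreover have "real n > 0" using n by simp
  ultimately have "x * cmod (1 + z * s X) \<le> 1 / x" by (rule mult_left_le_imp_le)
  then show ?thesis using x by (simp add: field_simps power2_eq_square)
qed

end

section \<open>Convergence of the energy\<close>

text \<open>
  The Coulson integrand of the normalized matrix. It is written through the Stieltjes transform, to
  which the loop equation applies; \<open>energy_density_eq\<close> gives its form in terms of eigenvalues.
\<close>

definition energy_density :: "nat \<Rightarrow> (nat set \<Rightarrow> bool) \<Rightarrow> real \<Rightarrow> real" where
  "energy_density n X x = Re (1 + Complex 0 x * stieltjes n (normalized_weights n X) (Complex 0 x))"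

definition scaled_energy :: "nat \<Rightarrow> (nat set \<Rightarrow> bool) \<Rightarrow> real" where
  "scaled_energy n X = mat_energy (mat n n (\<lambda>(i, j). normalized_weights n X i j)) / n"

lemma energy_density_eq:
  assumes n: "n > 0"
  obtains es :: "real list" where
    "length es = n"
    "scaled_energy n X = (\<Sum>e\<leftarrow>es. \<bar>e\<bar>) / n"
    "\<And>x. x > 0 \<Longrightarrow> energy_density n X x = (\<Sum>e\<leftarrow>es. e\<^sup>2 / (e\<^sup>2 + x\<^sup>2)) / n"
proof -
  obtain es :: "real list" where es: "length es = n"
    "char_poly (mat n n (\<lambda>(i, j). normalized_weights n X i j)) = (\<Prod>e\<leftarrow>es. [:- e, 1:])"
    "\<And>z. Im z > 0 \<Longrightarrow> stieltjes n (normalized_weights n X) z = (\<Sum>e\<leftarrow>es. 1 / (complex_of_real e - z)) / of_nat n"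
    using stieltjes_eq_eigenvalue_sum[OF symmetric_normalized_weights] by metis
  have "energy_density n X x = (\<Sum>e\<leftarrow>es. e\<^sup>2 / (e\<^sup>2 + x\<^sup>2)) / n" if x: "x > 0" for x
  proof -
    have pt: "1 - x * Im (1 / (complex_of_real e - Complex 0 x)) = e\<^sup>2 / (e\<^sup>2 + x\<^sup>2)" for e
    proof -
      have d: "e\<^sup>2 + x\<^sup>2 > 0" using x by (simp add: add_nonneg_pos)
      have "Im (1 / (complex_of_real e - Complex 0 x)) = x / (e\<^sup>2 + x\<^sup>2)"
        by (simp add: Im_divide)
      then have "1 - x * Im (1 / (complex_of_real e - Complex 0 x)) = (e\<^sup>2 + x\<^sup>2) / (e\<^sup>2 + x\<^sup>2) - x\<^sup>2 / (e\<^sup>2 + x\<^sup>2)"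
        using d x by (simp add: power2_eq_square)
      then show ?thesis unfolding diff_divide_distrib[symmetric] by simp
    qed
    have "(\<Sum>e\<leftarrow>es. e\<^sup>2 / (e\<^sup>2 + x\<^sup>2)) = length es - x * Im (\<Sum>e\<leftarrow>es. 1 / (complex_of_real e - Complex 0 x))"
      unfolding pt[symmetric] by (induction es) (simp_all add: distrib_left)
    moreover have "energy_density n X x = 1 - x * (Im (\<Sum>e\<leftarrow>es. 1 / (complex_of_real e - Complex 0 x)) / n)"
      using x by (simp add: energy_density_def es(3))
    ultimately show ?thesis using n es(1) by (simp add: diff_divide_distrib)
  qed
  note density = this
  show ?thesis
    by (rule that[OF es(1) _ density]) (simp_all add: scaled_energy_def mat_energy_eq_sum_abs_roots[OF es(2)])
qed

lemma Coulson_integral_energy: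
  assumes n: "n > 0"
  shows "has_bochner_integral lborel (\<lambda>x. indicator {0<..} x * energy_density n X x) (pi / 2 * scaled_energy n X)"
proof -
  obtain es :: "real list" where es: "length es = n"
    "scaled_energy n X = (\<Sum>e\<leftarrow>es. \<bar>e\<bar>) / n"
    "\<And>x. x > 0 \<Longrightarrow> energy_density n X x = (\<Sum>e\<leftarrow>es. e\<^sup>2 / (e\<^sup>2 + x\<^sup>2)) / n"
    using energy_density_eq[OF n] by metis
  have "has_bochner_integral lborel (\<lambda>x. \<Sum>e\<leftarrow>es. indicator {0<..} x * (e\<^sup>2 / (e\<^sup>2 + x\<^sup>2))) (\<Sum>e\<leftarrow>es. pi / 2 * \<bar>e\<bar>)"
  proof (induction es)
    case Nil
    show ?case by (simp add: has_bochner_integral_zero)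
  next
    case (Cons e es)
    show ?case unfolding list.map sum_list.Cons
      by (rule has_bochner_integral_add[OF Coulson_integral_abs Cons.IH])
  qed
  then have "has_bochner_integral lborel (\<lambda>x. (\<Sum>e\<leftarrow>es. indicator {0<..} x * (e\<^sup>2 / (e\<^sup>2 + x\<^sup>2))) / n) ((\<Sum>e\<leftarrow>es. pi / 2 * \<bar>e\<bar>) / n)"
    by (rule has_bochner_integral_divide_zero) 
  moreover have "(\<Sum>e\<leftarrow>es. indicator {0<..} x * (e\<^sup>2 / (e\<^sup>2 + x\<^sup>2))) / n = indicator {0<..} x * energy_density n X x" for x
    by (cases "x > 0") (auto simp: es(3) sum_list_const_mult)
  moreover have "(\<Sum>e\<leftarrow>es. pi / 2 * \<bar>e\<bar>) / n = pi / 2 * scaled_energy n X"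
    by (simp only: es(2) sum_list_const_mult times_divide_eq_right)
  ultimately show ?thesis by (simp only:)
qed

lemma dominating_bound: "y \<le> 1 \<Longrightarrow> y \<le> 1 / x\<^sup>2 \<Longrightarrow> x > 0 \<Longrightarrow> y \<le> 2 * (1\<^sup>2 / (1\<^sup>2 + x\<^sup>2))" for x y :: real
proof -
  assume y: "y \<le> 1" "y \<le> 1 / x\<^sup>2" and x: "x > 0"
  have "y * x\<^sup>2 \<le> 1" using y(2) x by (simp add: field_simps)
  with y(1) have "y * (1\<^sup>2 + x\<^sup>2) \<le> 2" by (simp add: distrib_left)
  moreover have "1\<^sup>2 + x\<^sup>2 > 0" by (simp add: add_pos_nonneg)
  ultimately show ?thesis by (simp add: pos_le_divide_eq)
qed

lemma energy_density_bounds: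
  assumes n: "n > 0" and x: "x > 0"
  shows "0 \<le> energy_density n X x" "energy_density n X x \<le> 2 * (1\<^sup>2 / (1\<^sup>2 + x\<^sup>2))"
proof -
  obtain es :: "real list" where es: "length es = n"
    "energy_density n X x = (\<Sum>e\<leftarrow>es. e\<^sup>2 / (e\<^sup>2 + x\<^sup>2)) / n"
    using energy_density_eq[OF n] x by metis
  have nn: "0 \<le> (\<Sum>e\<leftarrow>es. e\<^sup>2 / (e\<^sup>2 + x\<^sup>2))" for es by (induction es) auto
  have "e\<^sup>2 / (e\<^sup>2 + x\<^sup>2) \<le> 1" for e using x by (simp add: divide_le_eq add_nonneg_pos)
  then have "(\<Sum>e\<leftarrow>es. e\<^sup>2 / (e\<^sup>2 + x\<^sup>2)) \<le> length es" by (induction es) (auto simp: add_mono)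
  then have 1: "energy_density n X x \<le> 1" using n es by simp
  show "0 \<le> energy_density n X x" using nn[of es] es(2) by simp
  \<comment> \<open>The bound is pointwise in \<open>X\<close>, so any probability strictly between 0 and 1 serves here.\<close>
  interpret weighted_random_matrix n "1/2" x by unfold_locales (use n x in auto)
  have "energy_density n X x \<le> cmod (1 + z * s X)"
    unfolding energy_density_def s_def z_def by (rule complex_Re_le_cmod)
  also note one_plus_z_s_bound
  finally show "energy_density n X x \<le> 2 * (1\<^sup>2 / (1\<^sup>2 + x\<^sup>2))" using 1 x by (intro dominating_bound)
qed


lemma expectation_lborel_integral_swap:
  fixes F :: "'a \<Rightarrow> real \<Rightarrow> real"
  assumes M: "finite (set_pmf M)" and F: "\<And>X. integrable lborel (F X)"
  shows "integrable lborel (\<lambda>x. measure_pmf.expectation M (\<lambda>X. F X x))"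
    "measure_pmf.expectation M (\<lambda>X. integral\<^sup>L lborel (F X)) =
      integral\<^sup>L lborel (\<lambda>x. measure_pmf.expectation M (\<lambda>X. F X x))"
proof -
  have E: "measure_pmf.expectation M f = (\<Sum>X\<in>set_pmf M. pmf M X * f X)" for f :: "'a \<Rightarrow> real"
    using integral_measure_pmf[OF M, of M f] by simp
  show "integrable lborel (\<lambda>x. measure_pmf.expectation M (\<lambda>X. F X x))"
    unfolding E by (intro Bochner_Integration.integrable_sum integrable_mult_right F)
  show "measure_pmf.expectation M (\<lambda>X. integral\<^sup>L lborel (F X)) =
      integral\<^sup>L lborel (\<lambda>x. measure_pmf.expectation M (\<lambda>X. F X x))"
    unfolding E
    by (subst Bochner_Integration.integral_sum) (auto intro!: integrable_mult_right F)
qed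

text \<open>
  By Coulson's formula the expected error is at most \<open>2/\<pi>\<close> times the integral over \<open>x\<close> of the expected
  difference \<open>D n x\<close> of the integrands. For fixed \<open>x\<close> this tends to 0 by \<open>expected_stieltjes_error\<close>, and
  \<open>energy_density_bounds\<close> provides a majorant. The sequences are indexed by \<open>Suc n\<close> since the majorant
  fails for the empty matrix.
\<close>

lemma expected_energy_error_tendsto_0:
  assumes p: "0 < p" "p < 1"
  shows "(\<lambda>n. measure_pmf.expectation (coin_pmf (vertex_pairs n) p)
      (\<lambda>X. \<bar>scaled_energy n X - 4 / (3 * pi) * sqrt (p * (1 - p))\<bar>)) \<longlonglongrightarrow> 0"
proof -
  define E where "E n f = measure_pmf.expectation (coin_pmf (vertex_pairs n) p) f" for n and f :: "_ \<Rightarrow> real"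
  define \<sigma> where "\<sigma> = sqrt (p * (1 - p)) / 2"
  define c where "c = 4 / (3 * pi) * sqrt (p * (1 - p))"
  define f where "f x = 1 - x * semicircle_im \<sigma> x" for x
  define w :: "real \<Rightarrow> real" where "w x = 2 * (indicator {0<..} x * (1\<^sup>2 / (1\<^sup>2 + x\<^sup>2)))" for x
  define d where "d n X x = indicator {0<..} x * energy_density n X x - indicator {0<..} x * f x" for n X x
  define D where "D n x = E n (\<lambda>X. \<bar>d n X x\<bar>)" for n x
  have \<sigma>: "\<sigma> > 0" "\<sigma>\<^sup>2 \<le> 1"
  proof -
    show "\<sigma> > 0" using p by (simp add: \<sigma>_def)
    have "p * (1 - p) \<le> 1" using p by (intro mult_le_one) auto
    then show "\<sigma>\<^sup>2 \<le> 1" using p by (simp add: \<sigma>_def power_divide)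
  qed
  have int_d: "has_bochner_integral lborel (d n X) (pi / 2 * (scaled_energy n X - c))" if "n > 0" for n X
  proof -
    have "has_bochner_integral lborel (d n X) (pi / 2 * scaled_energy n X - 4 * \<sigma> / 3)"
      unfolding d_def[abs_def] f_def
      by (rule has_bochner_integral_diff[OF Coulson_integral_energy[OF that] semicircle_integral[OF \<sigma>(1)]])
    also have "pi / 2 * scaled_energy n X - 4 * \<sigma> / 3 = pi / 2 * (scaled_energy n X - c)"
      unfolding right_diff_distrib by (simp add: c_def \<sigma>_def)
    finally show ?thesis .
  qed
  have int_abs_d: "integrable lborel (\<lambda>x. \<bar>d n X x\<bar>)" if "n > 0" for n X
    using int_d[OF that] by (intro integrable_abs) (auto simp: has_bochner_integral_iff)
  have fin: "finite (set_pmf (coin_pmf (vertex_pairs n) p))" for n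
    by (simp add: finite_set_coin_pmf)
  have int_D: "integrable lborel (D n)" "E n (\<lambda>X. integral\<^sup>L lborel (\<lambda>x. \<bar>d n X x\<bar>)) = integral\<^sup>L lborel (D n)"
    if "n > 0" for n
    using expectation_lborel_integral_swap[OF fin[of n], of "\<lambda>X x. \<bar>d n X x\<bar>"] int_abs_d[OF that]
    by (simp_all add: D_def[abs_def] E_def)
  have d_le_w: "\<bar>d n X x\<bar> \<le> w x" if n: "n > 0" for n X x
  proof (cases "x > 0")
    case True
    have "f x \<in> {0..min 1 (\<sigma>\<^sup>2 / x\<^sup>2)}" unfolding f_def by (rule semicircle_im_bound[OF \<sigma>(1) True])
    moreover have "\<sigma>\<^sup>2 / x\<^sup>2 \<le> 1 / x\<^sup>2" using \<sigma>(2) by (rule divide_right_mono) simp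
    ultimately have "0 \<le> f x" "f x \<le> 2 * (1\<^sup>2 / (1\<^sup>2 + x\<^sup>2))"
      using dominating_bound[of "f x" x] True by auto
    then show ?thesis
      using energy_density_bounds[OF n True, of X] True by (simp add: d_def w_def abs_le_iff)
  qed (simp add: d_def w_def)
  have D_le_w: "\<bar>D n x\<bar> \<le> w x" if n: "n > 0" for n x
  proof -
    have "D n x \<le> E n (\<lambda>X. w x)"
      unfolding D_def E_def by (intro expectation_coin_mono d_le_w n) simp
    moreover have "D n x \<ge> 0" unfolding D_def E_def by (rule Bochner_Integration.integral_nonneg) simp
    ultimately show ?thesis by (simp add: E_def)
  qed
  have D_lim: "(\<lambda>n. D (Suc n) x) \<longlonglongrightarrow> 0" for x
  proof (cases "x > 0")
    case True
    define K where "K = (1 / x ^ 4 + 1) / 2 + (2 / x + 1 / x\<^sup>2 + 1 / x ^ 3 + 1 / x ^ 4) / x"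
    have "\<bar>D (Suc n) x\<bar> \<le> x * K * (1 / sqrt (real (Suc n)))" for n
    proof -
      interpret W: weighted_random_matrix "Suc n" p x by unfold_locales (use True p in auto)
      have dX: "\<bar>d (Suc n) X x\<bar> \<le> x * cmod (W.s X - W.m0)" for X
      proof -
        have "1 + W.z * W.m0 = complex_of_real (f x)"
          by (simp add: complex_eq_iff W.z W.m0_def f_def W.\<sigma>_def \<sigma>_def)
        then have "d (Suc n) X x = Re ((1 + W.z * W.s X) - (1 + W.z * W.m0))"
          using True by (simp add: d_def energy_density_def W.s_def W.z_def)
        then have "\<bar>d (Suc n) X x\<bar> \<le> cmod ((1 + W.z * W.s X) - (1 + W.z * W.m0))"
          using abs_Re_le_cmod by metis
        also have "(1 + W.z * W.s X) - (1 + W.z * W.m0) = W.z * (W.s X - W.m0)"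
          by (simp add: algebra_simps)
        finally show ?thesis by (simp only: norm_mult W.z(4))
      qed
      have "D (Suc n) x \<le> E (Suc n) (\<lambda>X. x * cmod (W.s X - W.m0))"
        unfolding D_def E_def by (intro expectation_coin_mono dX) simp
      also have "\<dots> = x * E (Suc n) (\<lambda>X. cmod (W.s X - W.m0))"
        unfolding E_def by (rule integral_mult_right_zero)
      also have "\<dots> \<le> x * (K / sqrt (real (Suc n)))"
        unfolding E_def K_def using True by (intro mult_left_mono W.expected_stieltjes_error) simp
      finally have "D (Suc n) x \<le> x * K * (1 / sqrt (real (Suc n)))" by simp
      moreover have "D (Suc n) x \<ge> 0" unfolding D_def E_def by (rule Bochner_Integration.integral_nonneg) simp
      ultimately show ?thesis by simp
    qed
    moreover have "(\<lambda>n. x * K * (1 / sqrt (real (Suc n)))) \<longlonglongrightarrow> x * K * 0"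
      by (intro tendsto_mult tendsto_const) real_asymp
    ultimately show ?thesis
      by (intro Lim_null_comparison[of "\<lambda>n. D (Suc n) x" "\<lambda>n. x * K * (1 / sqrt (real (Suc n)))"]) auto
  qed (simp add: D_def d_def E_def)
  have int_lim: "(\<lambda>n. integral\<^sup>L lborel (D (Suc n))) \<longlonglongrightarrow> integral\<^sup>L lborel (\<lambda>_ :: real. 0 :: real)"
  proof (rule integral_dominated_convergence[where w = w])
    show "integrable lborel w"
      unfolding w_def using Coulson_integral_abs[of 1]
      by (intro integrable_mult_right) (auto simp: has_bochner_integral_iff)
    show "D (Suc n) \<in> borel_measurable lborel" for n
      using int_D(1)[of "Suc n"] by (intro borel_measurable_integrable) simp
  qed (use D_lim D_le_w in auto)
  have le: "E n (\<lambda>X. \<bar>scaled_energy n X - c\<bar>) \<le> 2 / pi * integral\<^sup>L lborel (D n)" if n: "n > 0" for n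
  proof -
    have "\<bar>scaled_energy n X - c\<bar> \<le> 2 / pi * integral\<^sup>L lborel (\<lambda>x. \<bar>d n X x\<bar>)" for X
    proof -
      have "pi / 2 * \<bar>scaled_energy n X - c\<bar> = \<bar>integral\<^sup>L lborel (d n X)\<bar>"
        unfolding has_bochner_integral_integral_eq[OF int_d[OF n]] by (simp add: abs_mult)
      also have "\<dots> \<le> integral\<^sup>L lborel (\<lambda>x. \<bar>d n X x\<bar>)" by (rule integral_abs_bound)
      finally show ?thesis by (simp add: field_simps)
    qed
    then have "E n (\<lambda>X. \<bar>scaled_energy n X - c\<bar>) \<le> E n (\<lambda>X. 2 / pi * integral\<^sup>L lborel (\<lambda>x. \<bar>d n X x\<bar>))"
      unfolding E_def by (intro expectation_coin_mono) simp
    also have "\<dots> = 2 / pi * E n (\<lambda>X. integral\<^sup>L lborel (\<lambda>x. \<bar>d n X x\<bar>))"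
      unfolding E_def by (rule integral_mult_right_zero)
    finally show ?thesis unfolding int_D(2)[OF n] .
  qed
  have "(\<lambda>n. 2 / pi * integral\<^sup>L lborel (D (Suc n))) \<longlonglongrightarrow> 2 / pi * 0"
    using int_lim by (intro tendsto_mult tendsto_const) simp
  then have "(\<lambda>n. E (Suc n) (\<lambda>X. \<bar>scaled_energy (Suc n) X - c\<bar>)) \<longlonglongrightarrow> 0"
  proof (intro Lim_null_comparison[of "\<lambda>n. E (Suc n) (\<lambda>X. \<bar>scaled_energy (Suc n) X - c\<bar>)"
        "\<lambda>n. 2 / pi * integral\<^sup>L lborel (D (Suc n))"] always_eventually allI)
    fix n
    have "0 \<le> E (Suc n) (\<lambda>X. \<bar>scaled_energy (Suc n) X - c\<bar>)"
      unfolding E_def by (rule Bochner_Integration.integral_nonneg) simp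
    then show "norm (E (Suc n) (\<lambda>X. \<bar>scaled_energy (Suc n) X - c\<bar>)) \<le> 2 / pi * integral\<^sup>L lborel (D (Suc n))"
      using le[of "Suc n"] by simp
  qed simp
  then have "(\<lambda>n. E n (\<lambda>X. \<bar>scaled_energy n X - c\<bar>)) \<longlonglongrightarrow> 0"
    by (rule LIMSEQ_imp_Suc)
  then show ?thesis by (simp only: E_def c_def)
qed

section \<open>Random graphs have diameter two\<close>

definition diameter_two :: "nat \<Rightarrow> (nat set \<Rightarrow> bool) \<Rightarrow> bool" where
  "diameter_two n X \<longleftrightarrow>
     (\<forall>u<n. \<forall>v<n. u \<noteq> v \<longrightarrow> (\<exists>w<n. w \<noteq> u \<and> w \<noteq> v \<and> X {u, w} \<and> X {w, v})) \<and>
     (\<exists>u<n. \<exists>v<n. u \<noteq> v \<and> \<not> X {u, v})"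

lemma expectation_no_common_neighbour:
  assumes p: "0 \<le> p" "p \<le> 1" and uv: "u < n" "v < n" "u \<noteq> v"
  shows "measure_pmf.expectation (coin_pmf (vertex_pairs n) p)
      (\<lambda>X. \<Prod>w\<in>{..<n} - {u, v}. 1 - of_bool (X {u, w} \<and> X {w, v})) = (1 - p\<^sup>2) ^ (n - 2)"
proof -
  have "card ({..<n} - {u, v}) = n - 2"
    using uv by (subst card_Diff_subset) auto
  moreover have "measure_pmf.expectation (coin_pmf (vertex_pairs n) p)
      (\<lambda>X. \<Prod>w\<in>{..<n} - {u, v}. 1 - of_bool (X {u, w} \<and> X {w, v})) = (1 - p\<^sup>2) ^ card ({..<n} - {u, v})"
  proof (rule expectation_coin_prod_pairs[OF _ p])
    show "(\<lambda>w. {u, w}) ` ({..<n} - {u, v}) \<subseteq> vertex_pairs n"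
      and "(\<lambda>w. {w, v}) ` ({..<n} - {u, v}) \<subseteq> vertex_pairs n"
      using uv by (auto simp: pair_mem_vertex_pairs)
    show "inj_on (\<lambda>w. {u, w}) ({..<n} - {u, v})" and "inj_on (\<lambda>w. {w, v}) ({..<n} - {u, v})"
      by (auto simp: inj_on_def doubleton_eq_iff)
    show "(\<lambda>w. {u, w}) ` ({..<n} - {u, v}) \<inter> (\<lambda>w. {w, v}) ` ({..<n} - {u, v}) = {}"
      using uv by (auto simp: doubleton_eq_iff)
  qed auto
  ultimately show ?thesis by (simp only:)
qed

lemma expectation_complete:
  assumes p: "0 \<le> p" "p \<le> 1"
  shows "measure_pmf.expectation (coin_pmf (vertex_pairs n) p) (\<lambda>X. \<Prod>e\<in>vertex_pairs n. of_bool (X e)) =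
    p ^ (n choose 2)"
proof -
  have "measure_pmf.expectation (coin_pmf (vertex_pairs n) p) (\<lambda>X. \<Prod>e\<in>vertex_pairs n. of_bool (X e) :: real) =
      (\<Prod>e\<in>vertex_pairs n. measure_pmf.expectation (bernoulli_pmf p) of_bool)"
    by (rule expectation_prod_Pi_pmf) (auto intro: integrable_measure_pmf_finite)
  then show ?thesis using p by (simp add: card_vertex_pairs)
qed

text \<open>
  A union bound over the pairs without a common neighbour and the complete graph.
\<close>

lemma prob_not_diameter_two:
  assumes p: "0 \<le> p" "p \<le> 1" and n: "n \<ge> 2"
  shows "measure_pmf.prob (coin_pmf (vertex_pairs n) p) {X. \<not> diameter_two n X} \<le>
    (real n)\<^sup>2 * (1 - p\<^sup>2) ^ (n - 2) + p ^ (n - 1)"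
proof -
  let ?E = "measure_pmf.expectation (coin_pmf (vertex_pairs n) p)"
  define q where "q X u v = (if u \<noteq> v then \<Prod>w\<in>{..<n} - {u, v}. 1 - of_bool (X {u, w} \<and> X {w, v}) else 0 :: real)" for X u v
  define r where "r X = (\<Prod>e\<in>vertex_pairs n. of_bool (X e) :: real)" for X
  note I = integrable_coin_pmf[OF finite_vertex_pairs, of n p]
  have q0: "0 \<le> q X u v" for X u v by (auto simp: q_def intro!: prod_nonneg)
  have r0: "0 \<le> r X" for X by (auto simp: r_def intro!: prod_nonneg)
  have le: "indicator {X. \<not> diameter_two n X} X \<le> (\<Sum>u<n. \<Sum>v<n. q X u v) + r X" for X
  proof (cases "diameter_two n X")
    case True
    then show ?thesis using q0 r0 by (auto intro!: add_nonneg_nonneg sum_nonneg)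
  next
    case False
    have "1 \<le> (\<Sum>u<n. \<Sum>v<n. q X u v) + r X"
    proof (cases "\<exists>u<n. \<exists>v<n. u \<noteq> v \<and> \<not> X {u, v}")
      case True
      with False obtain u v where uv: "u < n" "v < n" "u \<noteq> v"
        "\<And>w. w < n \<Longrightarrow> w \<noteq> u \<Longrightarrow> w \<noteq> v \<Longrightarrow> \<not> (X {u, w} \<and> X {w, v})"
        unfolding diameter_two_def by blast
      have "1 = q X u v"
        unfolding q_def using uv by (simp del: de_Morgan_conj)
      also have "\<dots> \<le> (\<Sum>v<n. q X u v)"
        using uv q0 by (intro member_le_sum) auto
      also have "\<dots> \<le> (\<Sum>u<n. \<Sum>v<n. q X u v)"
        using uv q0 by (intro member_le_sum[where f = "\<lambda>u. \<Sum>v<n. q X u v"] sum_nonneg) auto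
      finally show ?thesis using r0[of X] by simp
    next
      case all: False
      have "r X = 1"
        unfolding r_def
      proof (rule prod.neutral, rule ballI)
        fix e assume "e \<in> vertex_pairs n"
        then obtain u v where "e = {u, v}" "u \<noteq> v" "u < n" "v < n"
          by (auto simp: vertex_pairs_def card_2_iff)
        with all show "of_bool (X e) = (1 :: real)" by auto
      qed
      moreover have "0 \<le> (\<Sum>u<n. \<Sum>v<n. q X u v)" using q0 by (intro sum_nonneg) auto
      ultimately show ?thesis by simp
    qed
    with False show ?thesis by simp
  qed
  have "measure_pmf.prob (coin_pmf (vertex_pairs n) p) {X. \<not> diameter_two n X} = ?E (indicator {X. \<not> diameter_two n X})"
    by simp
  also have "\<dots> \<le> ?E (\<lambda>X. (\<Sum>u<n. \<Sum>v<n. q X u v) + r X)"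
    by (rule expectation_coin_mono[OF finite_vertex_pairs le])
  also have "\<dots> = (\<Sum>u<n. \<Sum>v<n. ?E (\<lambda>X. q X u v)) + ?E r"
    by (simp add: Bochner_Integration.integral_add[OF I I] Bochner_Integration.integral_sum I)
  also have "\<dots> \<le> (\<Sum>u<n. \<Sum>v<n. (1 - p\<^sup>2) ^ (n - 2)) + p ^ (n - 1)"
  proof (intro add_mono sum_mono)
    have p2: "p\<^sup>2 \<le> 1" using p by (simp add: power_le_one)
    show "?E (\<lambda>X. q X u v) \<le> (1 - p\<^sup>2) ^ (n - 2)" if "u \<in> {..<n}" "v \<in> {..<n}" for u v
      using expectation_no_common_neighbour[OF p, of u n v] that p2 by (cases "u = v") (auto simp: q_def)
    have "n - 1 \<le> n choose 2"
    proof -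
      have "2 * (n - 1) \<le> n * (n - 1)" using n by (intro mult_right_mono) auto
      then have "2 * (n - 1) div 2 \<le> n * (n - 1) div 2" by (rule div_le_mono)
      then show ?thesis by (simp add: choose_two)
    qed
    then show "?E r \<le> p ^ (n - 1)"
      unfolding r_def expectation_complete[OF p] using p by (intro power_decreasing) auto
  qed
  also have "\<dots> = (real n)\<^sup>2 * (1 - p\<^sup>2) ^ (n - 2) + p ^ (n - 1)"
    by (simp add: power2_eq_square)
  finally show ?thesis .
qed

lemma prob_not_diameter_two_tendsto_0:
  assumes p: "0 < p" "p < 1"
  shows "(\<lambda>n. measure_pmf.prob (coin_pmf (vertex_pairs n) p) {X. \<not> diameter_two n X}) \<longlonglongrightarrow> 0"
proof (rule Lim_null_comparison)
  show "\<forall>\<^sub>F n in sequentially. norm (measure_pmf.prob (coin_pmf (vertex_pairs n) p) {X. \<not> diameter_two n X}) \<le>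
      (real n)\<^sup>2 * (1 - p\<^sup>2) ^ (n - 2) + p ^ (n - 1)"
    using eventually_ge_at_top[of "2 :: nat"] by eventually_elim (use prob_not_diameter_two p in auto)
  define q where "q = 1 - p\<^sup>2"
  have "p\<^sup>2 < 1" using p by (simp add: power_less_one_iff)
  then have "0 < q" "q < 1" using p by (auto simp: q_def)
  then have "(\<lambda>n. (real (n + 2))\<^sup>2 * q ^ n) \<longlonglongrightarrow> 0"
    by real_asymp
  moreover have "(\<lambda>n. p ^ (n + 1)) \<longlonglongrightarrow> 0"
    using p by real_asymp
  ultimately have "(\<lambda>n. (real (n + 2))\<^sup>2 * q ^ n + p ^ (n + 1)) \<longlonglongrightarrow> 0"
    by (rule tendsto_add_zero)
  then have "(\<lambda>n. (real n)\<^sup>2 * q ^ (n - 2) + p ^ (n - 1)) \<longlonglongrightarrow> 0"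
    by (intro LIMSEQ_offset[of "\<lambda>n. (real n)\<^sup>2 * q ^ (n - 2) + p ^ (n - 1)" 2]) simp
  then show "(\<lambda>n. (real n)\<^sup>2 * (1 - p\<^sup>2) ^ (n - 2) + p ^ (n - 1)) \<longlonglongrightarrow> 0"
    by (simp only: q_def)
qed

lemma mat_energy_rcw_matrix:
  assumes n: "n > 0" and X: "diameter_two n X"
  shows "mat_energy (rcw_matrix (graph_of n X)) = scaled_energy n X * real n powr (3 / 2)"
proof -
  have "rcw_matrix (graph_of n X) = mat n n (\<lambda>(i, j). if i = j then 0 else if X {i, j} then 1 / 2 else 1)"
    by (rule rcw_matrix_diameter_two) (use X in \<open>auto simp: diameter_two_def\<close>)
  also have "\<dots> = mat n n (\<lambda>(i, j). sqrt n * normalized_weights n X i j)"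
    using n by (intro eq_matI) (auto simp: normalized_weights_def edge_weight_def)
  finally have "mat_energy (rcw_matrix (graph_of n X)) = sqrt n * (scaled_energy n X * n)"
    using mat_energy_scale[OF symmetric_normalized_weights, of "sqrt n" n X] n by (simp add: scaled_energy_def)
  moreover have "real n powr (3 / 2) = sqrt n * n"
    using n powr_add[of "real n" "1 / 2" 1] by (simp add: powr_half_sqrt)
  ultimately show ?thesis by simp
qed

section \<open>The energy of the reciprocal complementary Wiener matrix\<close>

theorem corollary3p4:
  fixes p :: real
  assumes "0 < p" and "p < 1"
  shows "\<exists>\<epsilon> :: nat \<Rightarrow> real. \<epsilon> \<longlonglongrightarrow> 0 \<and>
    (\<lambda>n. measure_pmf.prob (random_graph n p)
       {G. \<exists>\<delta>. \<bar>\<delta>\<bar> \<le> \<epsilon> n \<and>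
            mat_energy (rcw_matrix G)
              = (4 / (3 * pi) * sqrt (p * (1 - p)) + \<delta>) * real n powr (3 / 2)})
      \<longlonglongrightarrow> 1"
proof -
  define c where "c = 4 / (3 * pi) * sqrt (p * (1 - p))"
  define P where "P n = measure_pmf.prob (coin_pmf (vertex_pairs n) p)" for n
  define a where "a n = measure_pmf.expectation (coin_pmf (vertex_pairs n) p) (\<lambda>X. \<bar>scaled_energy n X - c\<bar>)" for n
  \<comment> \<open>The square root leaves Markov's inequality the factor \<open>sqrt (a n)\<close>; the second summand keeps \<open>\<epsilon>\<close> positive.\<close>
  define \<epsilon> where "\<epsilon> n = sqrt (a n) + 1 / real (Suc n)" for n
  define Good where "Good n = {G. \<exists>\<delta>. \<bar>\<delta>\<bar> \<le> \<epsilon> n \<and> mat_energy (rcw_matrix G) = (c + \<delta>) * real n powr (3 / 2)}" for n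
  have a0: "a n \<ge> 0" for n unfolding a_def by (rule Bochner_Integration.integral_nonneg) simp
  have a: "a \<longlonglongrightarrow> 0" unfolding a_def c_def by (rule expected_energy_error_tendsto_0[OF assms])
  have sqrt_a: "(\<lambda>n. sqrt (a n)) \<longlonglongrightarrow> 0" using tendsto_real_sqrt[OF a] by simp
  have \<epsilon>: "\<epsilon> \<longlonglongrightarrow> 0"
    unfolding \<epsilon>_def using tendsto_add[OF sqrt_a LIMSEQ_inverse_real_of_nat] by (simp add: inverse_eq_divide)
  have Markov: "P n {X. \<not> \<bar>scaled_energy n X - c\<bar> \<le> \<epsilon> n} \<le> sqrt (a n)" for n
  proof -
    have pos: "\<epsilon> n > 0" unfolding \<epsilon>_def using a0[of n] by (intro add_nonneg_pos) auto
    let ?A = "{X. \<not> \<bar>scaled_energy n X - c\<bar> \<le> \<epsilon> n}"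
    have "\<epsilon> n * P n ?A = measure_pmf.expectation (coin_pmf (vertex_pairs n) p) (\<lambda>X. \<epsilon> n * indicator ?A X)"
      by (simp add: P_def)
    also have "\<dots> \<le> a n"
      unfolding a_def by (rule expectation_coin_mono) (auto split: split_indicator)
    also have "a n = sqrt (a n) * sqrt (a n)" using a0[of n] by simp
    also have "\<dots> \<le> \<epsilon> n * sqrt (a n)" by (rule mult_right_mono) (auto simp: \<epsilon>_def a0)
    finally show ?thesis using pos by simp
  qed
  have lower: "1 - (P n {X. \<not> diameter_two n X} + sqrt (a n)) \<le> measure_pmf.prob (random_graph n p) (Good n)"
    if n: "n > 0" for n
  proof -
    have sub: "UNIV - graph_of n -` Good n \<subseteq> {X. \<not> diameter_two n X} \<union> {X. \<not> \<bar>scaled_energy n X - c\<bar> \<le> \<epsilon> n}"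
    proof (rule subsetI, rule ccontr)
      fix X assume X: "X \<in> UNIV - graph_of n -` Good n"
        and "X \<notin> {X. \<not> diameter_two n X} \<union> {X. \<not> \<bar>scaled_energy n X - c\<bar> \<le> \<epsilon> n}"
      then have "diameter_two n X" "\<bar>scaled_energy n X - c\<bar> \<le> \<epsilon> n" by auto
      then have "graph_of n X \<in> Good n"
        unfolding Good_def using mat_energy_rcw_matrix[OF n]
        by (auto intro!: exI[of _ "scaled_energy n X - c"])
      with X show False by simp
    qed
    have "1 - measure_pmf.prob (random_graph n p) (Good n) = P n (UNIV - graph_of n -` Good n)"
      unfolding random_graph_def P_def measure_map_pmf
      by (subst measure_pmf.prob_compl[simplified, symmetric]) auto
    also have "\<dots> \<le> P n ({X. \<not> diameter_two n X} \<union> {X. \<not> \<bar>scaled_energy n X - c\<bar> \<le> \<epsilon> n})"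
      unfolding P_def by (rule measure_pmf.finite_measure_mono[OF sub]) simp
    also have "\<dots> \<le> P n {X. \<not> diameter_two n X} + P n {X. \<not> \<bar>scaled_energy n X - c\<bar> \<le> \<epsilon> n}"
      unfolding P_def by (rule measure_Un_le) auto
    finally show ?thesis using Markov[of n] by linarith
  qed
  have "(\<lambda>n. measure_pmf.prob (random_graph n p) (Good n)) \<longlonglongrightarrow> 1"
  proof (rule tendsto_sandwich)
    show "\<forall>\<^sub>F n in sequentially. 1 - (P n {X. \<not> diameter_two n X} + sqrt (a n)) \<le> measure_pmf.prob (random_graph n p) (Good n)"
      using eventually_gt_at_top[of "0 :: nat"] by eventually_elim (rule lower)
    show "(\<lambda>n. 1 - (P n {X. \<not> diameter_two n X} + sqrt (a n))) \<longlonglongrightarrow> 1"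
      using tendsto_diff[OF tendsto_const[of 1] tendsto_add[OF prob_not_diameter_two_tendsto_0[OF assms] sqrt_a]]
      by (simp add: P_def)
  qed auto
  with \<epsilon> show ?thesis unfolding Good_def c_def by blast
qed

end
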